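(* Let $\alpha\in(0,1)$ and let $u\in\mathscr{C}^{2+\alpha}(\mathbb{R})$. For $\tau>0$ define the difference operator $$\mathcal{B}_\tau^{\alpha}u(t)=\tau^{-\alpha}\sum_{\ell=0}^{\infty}\varpi_\ell^{(\alpha)}\,u(t-\ell\tau),$$ where $\varpi_\ell^{(\alpha)}$ $(\ell=0,1,\ldots)$ are the coefficients of the power series expansion $G(z)=\sum_{\ell=0}^\infty \varpi_\ell^{(\alpha)}z^\ell$, $|z|<1$, of $$G(z)=\left(\frac{3\alpha+1}{2\alpha}-\frac{2\alpha+1}{\alpha}z+\frac{\alpha+1}{2\alpha}z^2\right)^{\alpha}.$$ Then, for every $t\in\mathbb{R}$, $$\left({}_{\mathrm{RL}}\mathrm{D}_{-\infty,t}^{\alpha}u\right)\!\left(t+\tfrac{\tau}{2}\right)=\mathcal{B}_\tau^{\alpha}u(t)+\mathcal{O}(\tau^2)\quad\text{as }\tau\to0.$$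
   Context: For $\alpha\in(0,1)$, the Riemann-Liouville derivative with lower limit $-\infty$ is ${}_{\mathrm{RL}}\mathrm{D}_{-\infty,t}^{\alpha}u(t)=\frac{1}{\Gamma(1-\alpha)}\frac{\mathrm{d}}{\mathrm{d}t}\int_{-\infty}^{t}\frac{u(s)}{(t-s)^{\alpha}}\,\mathrm{d}s$. The function class is $$\mathscr{C}^{n+\alpha}(\mathbb{R})=\left\{u\ \middle|\ u\in L_1(\mathbb{R}),\ \int_{\mathbb{R}}(1+|\omega|)^{n+\alpha}|\widehat{u}(\omega)|\,\mathrm{d}\omega<\infty\right\},\qquad \widehat{u}(\omega)=\int_{\mathbb{R}}\mathrm{e}^{\mathrm{i}\omega t}u(t)\,\mathrm{d}t .$$ Elements of this class are identified with their continuous representatives. The $\alpha$-th power in $G$ is the branch analytic on $|z|<1$ that is positive at $z=0$. *)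

theory Defs
  imports "HOL-Complex_Analysis.Complex_Analysis" "HOL-Library.Landau_Symbols"
begin

text \<open>The sign convention is \<open>e\<close> to the power \<open>+ i \<omega> t\<close>, without normalising factor.\<close>

definition fourier :: "(real \<Rightarrow> complex) \<Rightarrow> real \<Rightarrow> complex" where
  "fourier u \<omega> = (LINT t|lborel. exp (\<i> * of_real (\<omega> * t)) * u t)"

text \<open>Elements of the class are functions rather than equivalence classes modulo null sets;
  the continuity condition selects the continuous representative.\<close>

definition frac_class :: "nat \<Rightarrow> real \<Rightarrow> (real \<Rightarrow> complex) set" where
  "frac_class n \<alpha> = {u. continuous_on UNIV u \<and> integrable lborel u \<and>
     integrable lborel (\<lambda>\<omega>. (1 + \<bar>\<omega>\<bar>) powr (real n + \<alpha>) * norm (fourier u \<omega>))}"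

text \<open>The Riemann--Liouville derivative with lower limit minus infinity, for orders between
  0 and 1. The singular endpoint \<open>s = t\<close> is a null set and is left out of the integral.
  Since \<^const>\<open>vector_derivative\<close> and the Lebesgue integral are total,
  \<open>has_RL_deriv_at\<close> records separately that the integrals converge and that the
  derivative exists.\<close>

definition RL_kernel :: "real \<Rightarrow> (real \<Rightarrow> complex) \<Rightarrow> real \<Rightarrow> real \<Rightarrow> complex" where
  "RL_kernel \<alpha> u t s = u s / of_real ((t - s) powr \<alpha>)"

definition RL_primitive :: "real \<Rightarrow> (real \<Rightarrow> complex) \<Rightarrow> real \<Rightarrow> complex" where
  "RL_primitive \<alpha> u t = (LINT s:{..<t}|lborel. RL_kernel \<alpha> u t s)"

definition RL_deriv :: "real \<Rightarrow> (real \<Rightarrow> complex) \<Rightarrow> real \<Rightarrow> complex" where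
  "RL_deriv \<alpha> u t = 1 / of_real (Gamma (1 - \<alpha>)) * vector_derivative (RL_primitive \<alpha> u) (at t)"

definition has_RL_deriv_at :: "real \<Rightarrow> (real \<Rightarrow> complex) \<Rightarrow> real \<Rightarrow> bool" where
  "has_RL_deriv_at \<alpha> u t \<longleftrightarrow>
     (\<forall>\<^sub>F x in nhds t. set_integrable lborel {..<x} (RL_kernel \<alpha> u x)) \<and>
     RL_primitive \<alpha> u differentiable (at t)"

definition gen_poly :: "real \<Rightarrow> complex \<Rightarrow> complex" where
  "gen_poly \<alpha> z = of_real ((3 * \<alpha> + 1) / (2 * \<alpha>)) - of_real ((2 * \<alpha> + 1) / \<alpha>) * z
     + of_real ((\<alpha> + 1) / (2 * \<alpha>)) * z\<^sup>2"

text \<open>\<open>G\<close> is the branch of the \<open>\<alpha>\<close>-th power of \<open>p\<close> that is analytic on the open unit disc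
  and positive at 0. Different admissible logarithms \<open>L\<close> with positive \<open>G 0\<close> give the same
  \<open>G\<close> on the disc.\<close>

definition positive_power_branch ::
    "real \<Rightarrow> (complex \<Rightarrow> complex) \<Rightarrow> (complex \<Rightarrow> complex) \<Rightarrow> bool" where
  "positive_power_branch \<alpha> p G \<longleftrightarrow>
     (\<exists>L. L holomorphic_on ball 0 1 \<and>
          (\<forall>z\<in>ball 0 1. exp (L z) = p z \<and> G z = exp (of_real \<alpha> * L z))) \<and>
     (\<exists>r>0. G 0 = of_real r)"

text \<open>\<open>w\<close> is the sequence of weights: the coefficients of the power series expansion of \<open>G\<close>
  on the open unit disc. They are automatically real; this is not imposed.\<close>

definition power_series_coeffs :: "(complex \<Rightarrow> complex) \<Rightarrow> (nat \<Rightarrow> complex) \<Rightarrow> bool" where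
  "power_series_coeffs G w \<longleftrightarrow> (\<forall>z. norm z < 1 \<longrightarrow> (\<lambda>l. w l * z ^ l) sums G z)"

definition diff_op ::
    "(nat \<Rightarrow> complex) \<Rightarrow> real \<Rightarrow> real \<Rightarrow> (real \<Rightarrow> complex) \<Rightarrow> real \<Rightarrow> complex" where
  "diff_op w \<alpha> \<tau> u t = of_real (\<tau> powr (- \<alpha>)) * (\<Sum>l. w l * u (t - real l * \<tau>))"

lemma generating_function_exists:
  assumes "0 < \<alpha>"
  shows "\<exists>G w. positive_power_branch \<alpha> (gen_poly \<alpha>) G \<and> power_series_coeffs G w"
proof -
  define a b where "a = (3 * \<alpha> + 1) / (2 * \<alpha>)" and "b = (\<alpha> + 1) / (2 * \<alpha>)"
  have ab: "0 < b" "b < a" using assms by (auto simp: a_def b_def field_simps)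
  define L where "L = (\<lambda>z. Ln (1 - z) + Ln (of_real a - of_real b * z))"
  define G where "G = (\<lambda>z. exp (of_real \<alpha> * L z))"
  have re: "Re (1 - z) > 0" "Re (of_real a - of_real b * z) > 0" if "z \<in> ball 0 1" for z :: complex
  proof -
    have "Re z < 1" using that complex_Re_le_cmod[of z] by simp
    then show "Re (1 - z) > 0" by simp
    have "b * Re z \<le> b * 1" using \<open>Re z < 1\<close> ab by (intro mult_left_mono) auto
    then have "b * Re z < a" using ab by linarith
    then show "Re (of_real a - of_real b * z) > 0" by simp
  qed
  have L: "L holomorphic_on ball 0 1"
    unfolding L_def using re
    by (intro holomorphic_intros) (auto simp: complex_nonpos_Reals_iff not_le)
  then have G: "G holomorphic_on ball 0 1"
    unfolding G_def by (intro holomorphic_intros)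
  have prod: "gen_poly \<alpha> z = (1 - z) * (of_real a - of_real b * z)" for z
  proof -
    have "(2 * \<alpha> + 1) / \<alpha> = a + b" using assms by (simp add: a_def b_def field_simps)
    then show ?thesis
      by (simp add: gen_poly_def flip: a_def b_def) (simp add: algebra_simps power2_eq_square)
  qed
  have "exp (L z) = gen_poly \<alpha> z" if "z \<in> ball 0 1" for z
  proof -
    have "1 - z \<noteq> 0" "of_real a - of_real b * z \<noteq> 0"
      using re[OF that] by (metis less_irrefl zero_complex.sel(1))+
    then show ?thesis by (simp add: L_def exp_add prod)
  qed
  moreover have "G 0 = of_real (exp (\<alpha> * ln a))"
    using ab by (simp add: G_def L_def Ln_of_real flip: exp_of_real)
  ultimately have "positive_power_branch \<alpha> (gen_poly \<alpha>) G"
    unfolding positive_power_branch_def using L G_def by (metis exp_gt_zero)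
  moreover have "power_series_coeffs G (\<lambda>l. (deriv ^^ l) G 0 / fact l)"
    unfolding power_series_coeffs_def using holomorphic_power_series[OF G] by simp
  ultimately show ?thesis by blast
qed

end

theory Submission
  imports Defs "HOL-Probability.Characteristic_Functions" "HOL-Real_Asymp.Real_Asymp"
begin

text \<open>Both sides are Fourier multipliers. By Fourier inversion, the Riemann--Liouville derivative has
  the symbol \<open>(-i\<omega>)\<^sup>\<alpha>\<close> and the difference operator the symbol \<open>\<tau>\<^sup>-\<^sup>\<alpha> G(e\<^sup>i\<^sup>\<omega>\<^sup>\<tau>)\<close>; the latter makes
  sense because the weights are absolutely summable, so that \<open>G\<close> extends continuously to the closed
  disc. With \<open>x = \<omega>\<tau>\<close>, the polynomial factors as \<open>(1 - z) (A - B z)\<close> with \<open>A - B = 1\<close>, and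
  \<open>\<bar>(-ix)\<^sup>\<alpha> e\<^sup>-\<^sup>i\<^sup>x\<^sup>/\<^sup>2 - G(e\<^sup>i\<^sup>x)\<bar> \<le> C \<bar>x\<bar>\<^sup>2\<^sup>+\<^sup>\<alpha>\<close> for all real \<open>x\<close>. Hence the symbols differ by at most
  \<open>C \<tau>\<^sup>2 \<bar>\<omega>\<bar>\<^sup>2\<^sup>+\<^sup>\<alpha>\<close>, which is integrable against the Fourier transform of \<open>u\<close>.\<close>

section \<open>The generating function on the closed unit disc\<close>

text \<open>The points \<open>e^(ix)\<close> lie on the boundary of the disc, where the hypotheses
  say nothing about \<open>G\<close> and where the polynomial vanishes at \<open>z = 1\<close>.
  Splitting off the factor \<open>1 - z\<close> resolves this: its binomial coefficients have
  constant sign from index 1 on, which forces absolute summability, while the second factor has its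
  root \<open>A / B > 1\<close> outside the closed disc. The coefficients of the polynomial are
  tuned so that \<open>\<alpha> * (B - 1 / 2) = 1 / 2\<close>; otherwise the symbols would already
  differ at order \<open>1 + \<alpha>\<close>. Low frequencies are a second obstacle: the fractional
  integral, before it is differentiated, has a symbol of order \<open>\<alpha> - 1\<close>, singular
  at 0. This is harmless because the transform of an integrable function is bounded and
  \<open>\<alpha> - 1 > -1\<close>. At high frequencies the weight of the class has exactly the
  exponent of the symbol error.\<close>

lemma power_series_continuous_on_cball:
  fixes c :: "nat \<Rightarrow> complex"
  assumes "summable (\<lambda>n. norm (c n))"
  shows "continuous_on (cball 0 1) (\<lambda>z. \<Sum>n. c n * z ^ n)"
proof (rule uniform_limit_theorem)
  show "uniform_limit (cball 0 1) (\<lambda>n z. \<Sum>i<n. c i * z ^ i) (\<lambda>z. \<Sum>n. c n * z ^ n) sequentially"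
    by (rule Weierstrass_m_test[OF _ assms])
       (auto simp: norm_mult norm_power intro!: mult_left_le power_le_one)
qed (auto intro!: always_eventually continuous_intros)

lemma power_series_summable_cball:
  fixes c :: "nat \<Rightarrow> complex"
  assumes "summable (\<lambda>n. norm (c n))" "norm z \<le> 1"
  shows "summable (\<lambda>n. norm (c n * z ^ n))"
  by (rule summable_comparison_test'[OF assms(1), of 0])
     (use assms(2) in \<open>auto simp: norm_mult norm_power intro!: mult_left_le power_le_one\<close>)

text \<open>Both sides are continuous on the closed disc and agree on its dense interior; absolute
  summability spares any Abel-type argument.\<close>

lemma power_series_sums_cball:
  fixes c :: "nat \<Rightarrow> complex"
  assumes c: "summable (\<lambda>n. norm (c n))" and g: "continuous_on (cball 0 1) g"
    and sums: "\<And>z. norm z < 1 \<Longrightarrow> (\<lambda>n. c n * z ^ n) sums g z" and z: "norm z \<le> 1"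
  shows "(\<lambda>n. c n * z ^ n) sums g z"
proof -
  have "(\<Sum>n. c n * z ^ n) - g z = 0"
  proof (rule continuous_constant_on_closure[where S = "ball 0 1" and f = "\<lambda>z. (\<Sum>n. c n * z ^ n) - g z"])
    show "continuous_on (closure (ball 0 1)) (\<lambda>z. (\<Sum>n. c n * z ^ n) - g z)"
      using power_series_continuous_on_cball[OF c] g by (auto intro: continuous_on_diff)
  qed (use sums z in \<open>auto simp: sums_iff\<close>)
  moreover have "summable (\<lambda>n. c n * z ^ n)"
    using power_series_summable_cball[OF c z] by (rule summable_norm_cancel)
  ultimately show ?thesis by (simp add: sums_iff)
qed

text \<open>The weights are known only through the sums of their power series, so uniqueness is what
  identifies them with an explicit sequence. A nonzero difference would have isolated zeros, yet it
  sums to 0 on the whole disc.\<close>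

lemma power_series_coeffs_unique:
  assumes "power_series_coeffs G v" "power_series_coeffs G w"
  shows "v = w"
proof (rule ccontr)
  assume "v \<noteq> w"
  then obtain m where m: "v m - w m \<noteq> 0" by auto
  have sums: "(\<lambda>n. (v n - w n) * (z - 0) ^ n) sums 0" if "norm (z - 0) < 1" for z
    using sums_diff[of "\<lambda>n. v n * z ^ n" "G z" "\<lambda>n. w n * z ^ n" "G z"] assms that
    by (simp add: power_series_coeffs_def algebra_simps)
  \<comment> \<open>The theorem on isolated zeros asks for a nonzero coefficient of positive index;
    evaluation at 0 settles index 0.\<close>
  have "m > 0"
    using sums[of 0] m by (cases m) (auto simp: powser_sums_zero_iff)
  show False
  proof (rule powser_0_nonzero[of 1 0 "\<lambda>n. v n - w n" "\<lambda>_. 0" m])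
    fix s :: real
    assume "0 < s" "\<And>z :: complex. z \<in> cball 0 s - {0} \<Longrightarrow> (0 :: complex) \<noteq> 0"
    from this(2)[of "of_real s"] this(1) show False by auto
  qed (use sums m \<open>m > 0\<close> in auto)
qed

text \<open>From index 1 on the numbers \<open>(\<alpha> gchoose n) * (- 1) ^ n\<close> are
  nonpositive. Their absolute values therefore add up to 1 minus a signed partial sum, and the
  signed partial sums have a nonnegative closed form.\<close>

lemma summable_abs_gbinomial:
  fixes \<alpha> :: real
  assumes "0 < \<alpha>" "\<alpha> < 1"
  shows "summable (\<lambda>n. \<bar>\<alpha> gchoose n\<bar>)"
proof -
  have p: "pochhammer (1 - \<alpha>) n \<ge> 0" for n
    using assms pochhammer_nonneg[of "1 - \<alpha>" n] by simp
  have sign: "\<bar>\<alpha> gchoose Suc n\<bar> = - ((\<alpha> gchoose Suc n) * (- 1) ^ Suc n)" for n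
  proof -
    have "(\<alpha> gchoose Suc n) * (- 1) ^ Suc n = - (\<alpha> * pochhammer (1 - \<alpha>) n / fact (Suc n))"
      by (simp add: gbinomial_pochhammer pochhammer_rec flip: power_mult_distrib del: fact_Suc)
    moreover have "\<bar>\<alpha> gchoose Suc n\<bar> = \<bar>(\<alpha> gchoose Suc n) * (- 1) ^ Suc n\<bar>"
      by (simp add: abs_mult)
    ultimately show ?thesis using p assms by simp
  qed
  have "summable (\<lambda>n. \<bar>\<alpha> gchoose Suc n\<bar>)"
  proof (rule summableI_nonneg_bounded[where x = 1])
    fix n
    have "(\<Sum>k\<le>n. (\<alpha> gchoose k) * (- 1) ^ k) = pochhammer (1 - \<alpha>) n / fact n"
      unfolding gbinomial_sum_lower_neg by (simp add: gbinomial_pochhammer flip: power_mult_distrib)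
    also have "\<dots> \<ge> 0" using p by simp
    also have "(\<Sum>k\<le>n. (\<alpha> gchoose k) * (- 1) ^ k) = 1 - (\<Sum>i<n. \<bar>\<alpha> gchoose Suc i\<bar>)"
      unfolding sign lessThan_Suc_atMost[symmetric] sum.lessThan_Suc_shift
      by (simp add: sum_negf)
    finally show "(\<Sum>i<n. \<bar>\<alpha> gchoose Suc i\<bar>) \<le> 1" by simp
  qed simp
  then show ?thesis by (subst (asm) summable_Suc_iff)
qed

lemma norm_gbinomial_of_real: "norm ((of_real \<alpha> :: complex) gchoose n) = \<bar>\<alpha> gchoose n\<bar>"
proof -
  have "(of_real \<alpha> :: complex) gchoose n = of_real (\<alpha> gchoose n)"
    by (simp add: gbinomial_pochhammer flip: pochhammer_of_real)
  then show ?thesis by simp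
qed

lemma Re_one_minus_nonneg: "norm z \<le> 1 \<Longrightarrow> Re (1 - z) \<ge> 0"
  using complex_Re_le_cmod[of z] by simp

text \<open>On the boundary the value comes from continuity. The critical point is
  \<open>z = 1\<close>: within the closed right half-plane the principal power is continuous at 0
  because \<open>\<alpha> > 0\<close>.\<close>

lemma binomial_series_cball:
  fixes \<alpha> :: real and z :: complex
  assumes "0 < \<alpha>" "\<alpha> < 1"
  defines "c \<equiv> \<lambda>n. (of_real \<alpha> gchoose n) * (- 1) ^ n"
  shows "summable (\<lambda>n. norm (c n :: complex))"
    and "norm z \<le> 1 \<Longrightarrow> (\<lambda>n. c n * z ^ n) sums (1 - z) powr of_real \<alpha>"
proof -
  show c: "summable (\<lambda>n. norm (c n :: complex))"
    using summable_abs_gbinomial[OF assms(1,2)]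
    by (simp add: c_def norm_mult norm_power norm_gbinomial_of_real)
  assume "norm z \<le> 1"
  then show "(\<lambda>n. c n * z ^ n) sums (1 - z) powr of_real \<alpha>"
  proof (rule power_series_sums_cball[OF c, rotated 2])
    show "continuous_on (cball 0 1) (\<lambda>z::complex. (1 - z) powr of_real \<alpha>)"
      using Re_one_minus_nonneg assms by (intro continuous_intros) auto
    show "(\<lambda>n. c n * z ^ n) sums (1 - z) powr of_real \<alpha>" if "norm z < 1" for z
      using gen_binomial_complex[of "- z" "of_real \<alpha>"] that
      by (simp add: c_def mult.assoc flip: power_mult_distrib)
  qed
qed

section \<open>Explicit form of the generating function and its coefficients\<close>

definition gen_A :: "real \<Rightarrow> real" where "gen_A \<alpha> = (3 * \<alpha> + 1) / (2 * \<alpha>)"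
definition gen_B :: "real \<Rightarrow> real" where "gen_B \<alpha> = (\<alpha> + 1) / (2 * \<alpha>)"

text \<open>Principal powers are taken factor by factor: on the closed disc \<open>1 - z\<close>
  stays in the closed right half-plane and the second factor has real part at least 1, so the branch
  cut is met only at the zero \<open>z = 1\<close>.\<close>

definition gen_fun :: "real \<Rightarrow> complex \<Rightarrow> complex" where
  "gen_fun \<alpha> z = (1 - z) powr of_real \<alpha> * (of_real (gen_A \<alpha>) - of_real (gen_B \<alpha>) * z) powr of_real \<alpha>"

text \<open>The second identity makes the factor \<open>A - B z\<close> equal 1 at
  \<open>z = 1\<close>; the last one is the order condition that cancels the first-order terms of
  the symbols.\<close>

lemma gen_AB:
  assumes "0 < \<alpha>"
  shows "gen_B \<alpha> > 0" "gen_A \<alpha> = gen_B \<alpha> + 1" "gen_A \<alpha> > 0" "\<alpha> * (gen_B \<alpha> - 1 / 2) = 1 / 2"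
  using assms by (auto simp: gen_A_def gen_B_def field_simps)

lemma gen_poly_factor:
  assumes "0 < \<alpha>"
  shows "gen_poly \<alpha> z = (1 - z) * (of_real (gen_A \<alpha>) - of_real (gen_B \<alpha>) * z)"
proof -
  have "(2 * \<alpha> + 1) / \<alpha> = gen_A \<alpha> + gen_B \<alpha>"
    using assms by (simp add: gen_A_def gen_B_def field_simps)
  then show ?thesis
    by (simp add: gen_poly_def flip: gen_A_def gen_B_def) (simp add: algebra_simps power2_eq_square)
qed

lemma Re_second_factor:
  assumes "0 < \<alpha>" "norm z \<le> 1"
  shows "Re (of_real (gen_A \<alpha>) - of_real (gen_B \<alpha>) * z) \<ge> 1"
proof -
  have "gen_B \<alpha> * Re z \<le> gen_B \<alpha> * 1"
    using assms complex_Re_le_cmod[of z] gen_AB[OF assms(1)] by (intro mult_left_mono) auto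
  then show ?thesis using gen_AB[OF assms(1)] by simp
qed

text \<open>Two logarithms of the same function on the disc differ by a constant \<open>c\<close> with
  \<open>exp c = 1\<close>; positivity at 0 forces \<open>exp (\<alpha> c) = 1\<close> as well.\<close>

lemma positive_power_branch_gen_poly:
  assumes "0 < \<alpha>" and branch: "positive_power_branch \<alpha> (gen_poly \<alpha>) G" and z: "norm z < 1"
  shows "G z = gen_fun \<alpha> z"
proof -
  let ?Q = "\<lambda>z::complex. of_real (gen_A \<alpha>) - of_real (gen_B \<alpha>) * z"
  define L0 where "L0 = (\<lambda>z. Ln (1 - z) + Ln (?Q z))"
  have re: "Re (1 - z) > 0" "Re (?Q z) > 0" if "z \<in> ball 0 1" for z
    using that complex_Re_le_cmod[of z] Re_second_factor[OF assms(1), of z] by auto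
  then have nz: "1 - z \<noteq> 0" "?Q z \<noteq> 0" if "z \<in> ball 0 1" for z
    using that by (metis less_irrefl zero_complex.sel(1))+
  have L0: "L0 holomorphic_on ball 0 1"
    unfolding L0_def using re
    by (intro holomorphic_intros) (auto simp: complex_nonpos_Reals_iff not_le)
  have L0p: "exp (L0 z) = gen_poly \<alpha> z" if "z \<in> ball 0 1" for z
    using nz[OF that] by (simp add: L0_def exp_add gen_poly_factor[OF assms(1)])
  have L0G: "exp (of_real \<alpha> * L0 z) = gen_fun \<alpha> z" if "z \<in> ball 0 1" for z
    using nz[OF that] by (simp add: L0_def gen_fun_def powr_def exp_add ring_distribs)
  obtain L r where L: "L holomorphic_on ball 0 1"
    and Lp: "\<And>z. z \<in> ball 0 1 \<Longrightarrow> exp (L z) = gen_poly \<alpha> z"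
    and LG: "\<And>z. z \<in> ball 0 1 \<Longrightarrow> G z = exp (of_real \<alpha> * L z)"
    and r: "r > 0" "G 0 = of_real r"
    using branch unfolding positive_power_branch_def by blast
  let ?D = "\<lambda>z. L z - L0 z"
  have D: "?D holomorphic_on ball 0 1" by (intro holomorphic_intros L L0)
  have D1: "exp (?D z) = 1" if "z \<in> ball 0 1" for z
    using Lp[OF that] L0p[OF that] by (metis exp_diff exp_not_eq_zero divide_self)
  have "(?D has_field_derivative 0) (at z within ball 0 1)" if zb: "z \<in> ball 0 1" for z
  proof -
    have d: "(?D has_field_derivative deriv ?D z) (at z)"
      using holomorphic_derivI[OF D _ zb] by simp
    have "((\<lambda>z. exp (?D z)) has_field_derivative exp (?D z) * deriv ?D z) (at z)"
      using d by (rule DERIV_fun_exp)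
    moreover have "((\<lambda>z. exp (?D z)) has_field_derivative 0) (at z)"
    proof (rule has_field_derivative_transform_within_open[where f = "\<lambda>_. 1"])
      show "z \<in> ball 0 1" by fact
    qed (use D1 in auto)
    ultimately have "exp (?D z) * deriv ?D z = 0" by (rule DERIV_unique)
    then show ?thesis using d by (simp add: has_field_derivative_at_within)
  qed
  then obtain c where c: "\<And>z. z \<in> ball 0 1 \<Longrightarrow> L z = L0 z + c"
    using has_field_derivative_zero_constant[of "ball (0::complex) 1" ?D]
    by (auto simp: algebra_simps)
  \<comment> \<open>\<open>exp c = 1\<close> makes \<open>c\<close> purely imaginary, hence also its
    multiple by \<open>\<alpha>\<close>. The exponential of that multiple has modulus 1 and is a
    quotient of the positive numbers \<open>G 0\<close> and \<open>gen_fun \<alpha> 0\<close>, so it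
    is 1.\<close>
  have "norm (exp c) = 1" using D1[of 0] c[of 0] by simp
  then have "norm (exp (of_real \<alpha> * c)) = 1" by simp
  moreover have "of_real r = of_real (gen_A \<alpha> powr \<alpha>) * exp (of_real \<alpha> * c)"
  proof -
    have "of_real r = gen_fun \<alpha> 0 * exp (of_real \<alpha> * c)"
      using r LG[of 0] c[of 0] L0G[of 0] by (simp add: ring_distribs exp_add)
    then show ?thesis
      using gen_AB(3)[OF assms(1)] by (simp add: gen_fun_def powr_of_real)
  qed
  then have "exp (of_real \<alpha> * c) = of_real (r / gen_A \<alpha> powr \<alpha>)"
    using gen_AB[OF assms(1)] by (simp add: field_simps)
  ultimately have "exp (of_real \<alpha> * c) = 1"
    using r gen_AB[OF assms(1)] by (metis abs_of_pos divide_pos_pos norm_of_real of_real_1 powr_gt_zero less_irrefl)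
  then show ?thesis
    using LG[of z] c[of z] L0G[of z] z by (simp add: ring_distribs exp_add)
qed

text \<open>The weights are the Cauchy product of the binomial coefficients of
  \<open>(1 - z)^\<alpha>\<close> and those of \<open>A^\<alpha> (1 - q z)^\<alpha>\<close> with
  \<open>q = B / A\<close>. Both sequences are absolutely summable, hence so is their
  product.\<close>

proposition generating_coeffs:
  assumes "0 < \<alpha>" "\<alpha> < 1"
    and branch: "positive_power_branch \<alpha> (gen_poly \<alpha>) G" and w: "power_series_coeffs G w"
  shows "summable (\<lambda>l. norm (w l))"
    and "norm z \<le> 1 \<Longrightarrow> (\<lambda>l. w l * z ^ l) sums gen_fun \<alpha> z"
proof -
  let ?A = "gen_A \<alpha>" and ?B = "gen_B \<alpha>"
  define c :: "nat \<Rightarrow> complex" where "c = (\<lambda>n. (of_real \<alpha> gchoose n) * (- 1) ^ n)"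
  define q where "q = ?B / ?A"
  have q: "0 < q" "q \<le> 1" using gen_AB[OF assms(1)] by (auto simp: q_def)
  define d where "d = (\<lambda>n. of_real (?A powr \<alpha>) * (c n * of_real q ^ n))"
  define v where "v = (\<lambda>n. \<Sum>i\<le>n. c i * d (n - i))"
  have c: "summable (\<lambda>n. norm (c n))"
    unfolding c_def by (rule binomial_series_cball(1)[OF assms(1,2)])
  have "summable (\<lambda>n. norm (c n * of_real q ^ n))"
    using q by (intro power_series_summable_cball[OF c]) simp
  then have d: "summable (\<lambda>n. norm (d n))"
    unfolding d_def norm_mult[of "of_real (?A powr \<alpha>)"] by (rule summable_mult)
  have "summable (\<lambda>n. \<Sum>i\<le>n. norm (c i) * norm (d (n - i)))"
    using c d by (intro summable_Cauchy_product) simp_all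
  then have v: "summable (\<lambda>n. norm (v n))"
  proof (rule summable_comparison_test'[of _ 0])
    show "norm (norm (v n)) \<le> (\<Sum>i\<le>n. norm (c i) * norm (d (n - i)))" for n
      unfolding v_def by (simp add: sum_norm_le norm_mult)
  qed
  have sums: "(\<lambda>n. v n * z ^ n) sums gen_fun \<alpha> z" if z: "norm z \<le> 1" for z
  proof -
    have 1: "(\<lambda>n. c n * z ^ n) sums (1 - z) powr of_real \<alpha>"
      unfolding c_def by (rule binomial_series_cball(2)[OF assms(1,2) z])
    have "norm (of_real q * z) \<le> 1"
      using q z by (simp add: norm_mult mult_le_one)
    then have "(\<lambda>n. c n * (of_real q * z) ^ n) sums (1 - of_real q * z) powr of_real \<alpha>"
      unfolding c_def by (rule binomial_series_cball(2)[OF assms(1,2)])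
    then have "(\<lambda>n. of_real (?A powr \<alpha>) * (c n * (of_real q * z) ^ n)) sums
        (of_real (?A powr \<alpha>) * (1 - of_real q * z) powr of_real \<alpha>)"
      by (rule sums_mult)
    moreover have "of_real (?A powr \<alpha>) * (1 - of_real q * z) powr of_real \<alpha>
        = (of_real ?A - of_real ?B * z) powr of_real \<alpha>"
    proof -
      have "of_real ?A - of_real ?B * z = of_real ?A * (1 - of_real q * z)"
        using gen_AB(3)[OF assms(1)] by (simp add: q_def right_diff_distrib flip: mult.assoc)
      then show ?thesis
        using gen_AB(3)[OF assms(1)] by (simp add: powr_times_real_left powr_of_real)
    qed
    ultimately have 2: "(\<lambda>n. d n * z ^ n) sums (of_real ?A - of_real ?B * z) powr of_real \<alpha>"
      by (simp add: d_def power_mult_distrib mult_ac)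
    have "(\<lambda>n. \<Sum>i\<le>n. (c i * z ^ i) * (d (n - i) * z ^ (n - i))) sums
        ((\<Sum>n. c n * z ^ n) * (\<Sum>n. d n * z ^ n))"
      by (intro Cauchy_product_sums power_series_summable_cball c d z)
    moreover have "(\<Sum>i\<le>n. (c i * z ^ i) * (d (n - i) * z ^ (n - i))) = v n * z ^ n" for n
      unfolding v_def sum_distrib_right
      by (rule sum.cong) (auto simp: mult_ac simp flip: power_add)
    ultimately show ?thesis
      using 1 2 by (simp add: gen_fun_def sums_iff)
  qed
  have "power_series_coeffs G v"
    unfolding power_series_coeffs_def
    using sums positive_power_branch_gen_poly[OF assms(1) branch] by simp
  then have "v = w" using w by (rule power_series_coeffs_unique)
  with v sums show "summable (\<lambda>l. norm (w l))"
    and "norm z \<le> 1 \<Longrightarrow> (\<lambda>l. w l * z ^ l) sums gen_fun \<alpha> z" by auto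
qed

section \<open>Comparison of the two symbols on the real line\<close>

lemma powr_mult_half_plane:
  assumes "Re a \<ge> 0" "Re b > 0"
  shows "(a * b) powr c = a powr c * b powr c"
proof (cases "a = 0")
  case False
  have "b \<noteq> 0" using assms by auto
  have "\<bar>Im (Ln a)\<bar> \<le> pi / 2" "\<bar>Im (Ln b)\<bar> < pi / 2"
    using assms False \<open>b \<noteq> 0\<close> Re_Ln_pos_le[of a] Re_Ln_pos_lt[of b] by blast+
  \<comment> \<open>The two arguments add up to less than pi in modulus, so no multiple of
    \<open>2 * pi\<close> has to be corrected.\<close>
  then have "Ln (a * b) = Ln a + Ln b"
    using False \<open>b \<noteq> 0\<close> by (intro Ln_times_simple) auto
  then show ?thesis
    using False \<open>b \<noteq> 0\<close> by (simp add: powr_def ring_distribs exp_add)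
qed simp

lemma norm_ln_1p_diff_le:
  fixes z :: complex
  assumes "norm z \<le> 1 / 2"
  shows "norm (Ln (1 + z) - z) \<le> 2 * (norm z)\<^sup>2"
proof -
  have "norm (Ln (1 + z) - z) \<le> (norm z)\<^sup>2 / (1 - norm z)"
    using assms by (intro Ln_approx_linear) simp
  also have "\<dots> \<le> (norm z)\<^sup>2 / (1 / 2)"
    using assms by (intro divide_left_mono) auto
  finally show ?thesis by simp
qed



lemma norm_gen_fun_le:
  assumes "0 < \<alpha>" "norm z \<le> 1"
  shows "norm (gen_fun \<alpha> z) \<le> 2 powr \<alpha> * (gen_A \<alpha> + gen_B \<alpha>) powr \<alpha>"
proof -
  have "norm (1 - z) \<le> 2"
    using norm_triangle_ineq4[of 1 z] assms(2) by simp
  moreover have "norm (of_real (gen_A \<alpha>) - of_real (gen_B \<alpha>) * z) \<le> gen_A \<alpha> + gen_B \<alpha> * norm z"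
    using norm_triangle_ineq4[of "of_real (gen_A \<alpha>)" "of_real (gen_B \<alpha>) * z"] gen_AB[OF assms(1)]
    by (simp add: norm_mult)
  moreover have "gen_B \<alpha> * norm z \<le> gen_B \<alpha>"
    using assms(2) gen_AB[OF assms(1)] by (intro mult_left_le) auto
  ultimately show ?thesis
    unfolding gen_fun_def norm_mult using assms(1)
    by (intro mult_mono) (auto simp: norm_powr_real_powr' intro!: powr_mono2)
qed

text \<open>Writing \<open>1 - e\<^sup>i\<^sup>x = (-i x) q\<close>, the choice of the generating polynomial makes the first-order
  terms of \<open>\<alpha> (Ln q + Ln (A - B e\<^sup>i\<^sup>x))\<close> add up to \<open>- i x / 2\<close>, which is the half-step shift.\<close>

lemma symbol_estimate_near_0:
  fixes \<alpha> x :: real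
  assumes "0 < \<alpha>"
  defines "B \<equiv> gen_B \<alpha>"
  defines "K \<equiv> \<alpha> * (3 + B + 2 * B\<^sup>2)"
  assumes x: "\<bar>x\<bar> \<le> 1 / 2" "B * \<bar>x\<bar> \<le> 1 / 2" "K * x\<^sup>2 \<le> 1 / 2"
  shows "norm ((- \<i> * of_real x) powr of_real \<alpha> * exp (- \<i> * of_real x / 2)
           - gen_fun \<alpha> (exp (\<i> * of_real x))) \<le> 2 * K * \<bar>x\<bar> powr (2 + \<alpha>)"
proof (cases "x = 0")
  case True
  then show ?thesis by (simp add: gen_fun_def)
next
  case False
  let ?z = "exp (\<i> * of_real x)"
  \<comment> \<open>\<open>1 + p\<close> is \<open>(e^(ix) - 1) / (ix)\<close> and
    \<open>1 + m\<close> is the second factor \<open>A - B e^(ix)\<close>; to first order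
    \<open>p\<close> is \<open>ix / 2\<close> and \<open>m\<close> is \<open>- B ix\<close>.\<close>
  define p where "p = (?z - 1) / (\<i> * of_real x) - 1"
  define m where "m = - of_real B * (?z - 1)"
  have B: "B > 0" using gen_AB[OF assms(1)] by (simp add: B_def)
  have e0: "norm (?z - 1) \<le> \<bar>x\<bar>" using iexp_approx1[of x 0] by simp
  have e1: "norm (?z - 1 - \<i> * of_real x) \<le> x\<^sup>2 / 2"
    using iexp_approx1[of x 1] by (simp add: algebra_simps power2_eq_square)
  \<comment> \<open>\<open>p\<close> contains a division by \<open>x\<close>, so it needs one more
    order of the exponential series than \<open>m\<close>.\<close>
  have e2: "norm (?z - 1 - \<i> * of_real x - (\<i> * of_real x)\<^sup>2 / 2) \<le> \<bar>x\<bar> ^ 3 / 6"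
    using iexp_approx1[of x 2] by (simp add: numeral_2_eq_2 numeral_3_eq_3 algebra_simps)
  have "p - \<i> * of_real x / 2 = (?z - 1 - \<i> * of_real x - (\<i> * of_real x)\<^sup>2 / 2) / (\<i> * of_real x)"
    using False by (simp add: p_def field_simps power2_eq_square)
  then have "norm (p - \<i> * of_real x / 2) = norm (?z - 1 - \<i> * of_real x - (\<i> * of_real x)\<^sup>2 / 2) / \<bar>x\<bar>"
    by (simp add: norm_divide norm_mult)
  also have "\<dots> \<le> (\<bar>x\<bar> ^ 3 / 6) / \<bar>x\<bar>" by (intro divide_right_mono e2) simp
  also have "\<dots> = x\<^sup>2 / 6" using False by (simp add: power2_eq_square power3_eq_cube)
  finally have p1: "norm (p - \<i> * of_real x / 2) \<le> x\<^sup>2 / 6" .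
  have "\<bar>x\<bar> * \<bar>x\<bar> \<le> 1 * \<bar>x\<bar>" using x(1) by (intro mult_right_mono) auto
  then have x2: "x\<^sup>2 \<le> \<bar>x\<bar>" by (simp add: power2_eq_square)
  have "norm p \<le> norm (p - \<i> * of_real x / 2) + norm (\<i> * of_real x / 2)"
    using norm_triangle_ineq[of "p - \<i> * of_real x / 2" "\<i> * of_real x / 2"] by simp
  also have "\<dots> \<le> x\<^sup>2 / 6 + \<bar>x\<bar> / 2" using p1 by (simp add: norm_mult)
  finally have p: "norm p \<le> \<bar>x\<bar>" using x2 by linarith
  have "norm (Ln (1 + p) - p) \<le> 2 * (norm p)\<^sup>2"
    using p x(1) by (intro norm_ln_1p_diff_le) simp
  also have "\<dots> \<le> 2 * x\<^sup>2" using power_mono[OF p, of 2] by simp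
  finally have lp: "norm (Ln (1 + p) - p) \<le> 2 * x\<^sup>2" .
  have "norm (Ln (1 + p) - \<i> * of_real x / 2) \<le> norm (Ln (1 + p) - p) + norm (p - \<i> * of_real x / 2)"
    using norm_triangle_ineq[of "Ln (1 + p) - p" "p - \<i> * of_real x / 2"] by simp
  with lp p1 zero_le_power2[of x] have L1: "norm (Ln (1 + p) - \<i> * of_real x / 2) \<le> 3 * x\<^sup>2"
    by linarith
  have m: "norm m \<le> B * \<bar>x\<bar>"
    using e0 B by (simp add: m_def norm_mult mult_left_mono)
  have "m + of_real B * (\<i> * of_real x) = - of_real B * (?z - 1 - \<i> * of_real x)"
    by (simp add: m_def algebra_simps)
  then have "norm (m + of_real B * (\<i> * of_real x)) = B * norm (?z - 1 - \<i> * of_real x)"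
    using B by (simp add: norm_mult)
  also have "\<dots> \<le> B * x\<^sup>2"
    using e1 B zero_le_power2[of x] by (intro mult_left_mono) linarith+
  finally have m1: "norm (m + of_real B * (\<i> * of_real x)) \<le> B * x\<^sup>2" .
  have "norm (Ln (1 + m) - m) \<le> 2 * (norm m)\<^sup>2"
    using m x(2) by (intro norm_ln_1p_diff_le) simp
  also have "\<dots> \<le> 2 * (B\<^sup>2 * x\<^sup>2)" using power_mono[OF m, of 2] by (simp add: power_mult_distrib)
  finally have lm: "norm (Ln (1 + m) - m) \<le> 2 * (B\<^sup>2 * x\<^sup>2)" .
  have "norm (Ln (1 + m) + of_real B * (\<i> * of_real x)) \<le> norm (Ln (1 + m) - m) + norm (m + of_real B * (\<i> * of_real x))"
    using norm_triangle_ineq[of "Ln (1 + m) - m" "m + of_real B * (\<i> * of_real x)"] by simp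
  with lm m1 have L2: "norm (Ln (1 + m) + of_real B * (\<i> * of_real x)) \<le> 2 * (B\<^sup>2 * x\<^sup>2) + B * x\<^sup>2" by simp
  \<comment> \<open>\<open>exp H\<close> is the quotient of \<open>gen_fun\<close> and
    \<open>(-ix)^\<alpha> e^(-ix/2)\<close>. The linear terms of \<open>H\<close> cancel, and the
    summands 3, \<open>B\<close> and \<open>2 * B\<^sup>2\<close> of \<open>K\<close> come from the
    quadratic remainders \<open>L1\<close> and \<open>L2\<close>.\<close>
  define H where "H = of_real \<alpha> * (Ln (1 + p) + Ln (1 + m)) + \<i> * of_real x / 2"
  have "H = of_real \<alpha> * ((Ln (1 + p) - \<i> * of_real x / 2) + (Ln (1 + m) + of_real B * (\<i> * of_real x)))"
  proof -
    have "\<i> * of_real x / 2 = of_real (\<alpha> * (B - 1 / 2)) * (\<i> * of_real x)"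
      unfolding B_def gen_AB(4)[OF assms(1)] by simp
    then show ?thesis unfolding H_def by (simp add: algebra_simps)
  qed
  then have "norm H = \<alpha> * norm ((Ln (1 + p) - \<i> * of_real x / 2) + (Ln (1 + m) + of_real B * (\<i> * of_real x)))"
    using assms(1) by (simp add: norm_mult)
  also have "\<dots> \<le> \<alpha> * (3 * x\<^sup>2 + (2 * (B\<^sup>2 * x\<^sup>2) + B * x\<^sup>2))"
    using assms(1) by (intro mult_left_mono norm_triangle_mono L1 L2) simp
  also have "\<dots> = K * x\<^sup>2" by (simp add: K_def algebra_simps)
  finally have H: "norm H \<le> K * x\<^sup>2" .
  have "norm (exp H - 1) \<le> 3 / 2 * norm H"
    using H x(3) by (intro norm_exp_bounds) simp
  also have "\<dots> \<le> 2 * (K * x\<^sup>2)" using H norm_ge_zero[of H] by linarith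
  finally have E: "norm (exp H - 1) \<le> 2 * (K * x\<^sup>2)" .
  have Re_p: "Re (1 + p) > 0"
    using abs_Re_le_cmod[of p] p x(1) by auto
  have nz: "1 + p \<noteq> 0" "1 + m \<noteq> 0"
  proof -
    show "1 + p \<noteq> 0" using Re_p by (metis less_irrefl zero_complex.sel(1))
    have "Re (1 + m) > 0" using abs_Re_le_cmod[of m] m x(2) by auto
    then show "1 + m \<noteq> 0" by (metis less_irrefl zero_complex.sel(1))
  qed
  have f1: "1 - ?z = (- \<i> * of_real x) * (1 + p)"
    using False by (simp add: p_def field_simps)
  have f2: "of_real (gen_A \<alpha>) - of_real (gen_B \<alpha>) * ?z = 1 + m"
    using gen_AB(2)[OF assms(1)] by (simp add: m_def B_def algebra_simps)
  \<comment> \<open>The base \<open>-ix\<close> lies on the imaginary axis, a limiting case that the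
    product rule for powers admits in its first factor only.\<close>
  have "gen_fun \<alpha> ?z = (- \<i> * of_real x) powr of_real \<alpha> * ((1 + p) powr of_real \<alpha> * (1 + m) powr of_real \<alpha>)"
    unfolding gen_fun_def f2 unfolding f1 using Re_p
    by (subst powr_mult_half_plane) (auto simp: mult.assoc)
  also have "(1 + p) powr of_real \<alpha> * (1 + m) powr of_real \<alpha> = exp (- \<i> * of_real x / 2) * exp H"
    using nz by (simp add: powr_def H_def flip: exp_add) (simp add: algebra_simps)
  finally have G: "gen_fun \<alpha> ?z = (- \<i> * of_real x) powr of_real \<alpha> * exp (- \<i> * of_real x / 2) * exp H"
    by (simp add: mult.assoc)
  have "norm ((- \<i> * of_real x) powr of_real \<alpha> * exp (- \<i> * of_real x / 2) - gen_fun \<alpha> ?z)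
      = norm ((- \<i> * of_real x) powr of_real \<alpha> * exp (- \<i> * of_real x / 2) * (exp H - 1))"
    unfolding G by (subst norm_minus_commute) (simp add: algebra_simps)
  also have "\<dots> = \<bar>x\<bar> powr \<alpha> * norm (exp H - 1)"
    by (simp add: norm_mult norm_powr_real_powr')
  also have "\<dots> \<le> \<bar>x\<bar> powr \<alpha> * (2 * (K * x\<^sup>2))" by (intro mult_left_mono E) simp
  also have "\<dots> = 2 * K * \<bar>x\<bar> powr (2 + \<alpha>)"
    using False by (simp add: powr_add powr_numeral)
  finally show ?thesis .
qed

proposition symbol_estimate:
  assumes "0 < \<alpha>"
  obtains C where "C \<ge> 0" "\<And>x. norm ((- \<i> * of_real x) powr of_real \<alpha> * exp (- \<i> * of_real x / 2)
           - gen_fun \<alpha> (exp (\<i> * of_real x))) \<le> C * \<bar>x\<bar> powr (2 + \<alpha>)"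
proof -
  define B where "B = gen_B \<alpha>"
  define K where "K = \<alpha> * (3 + B + 2 * B\<^sup>2)"
  have B: "B > 0" using gen_AB[OF assms] by (simp add: B_def)
  have K: "K > 0" unfolding K_def using assms B by (intro mult_pos_pos add_pos_pos) auto
  \<comment> \<open>The three bounds yield the smallness conditions of the local estimate; as
    \<open>|x| \<le> 1\<close>, the quantity \<open>K * x\<^sup>2\<close> is at most
    \<open>K * d\<close>.\<close>
  define d where "d = min (1 / 2) (min (1 / (2 * B)) (1 / (2 * K)))"
  have d: "0 < d" "d \<le> 1 / 2" "B * d \<le> 1 / 2" "K * d \<le> 1 / 2"
  proof -
    show "0 < d" "d \<le> 1 / 2" using B K by (auto simp: d_def)
    have "d \<le> 1 / (2 * B)" by (auto simp: d_def)
    then show "B * d \<le> 1 / 2" using B by (simp add: field_simps)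
    have "d \<le> 1 / (2 * K)" by (auto simp: d_def)
    then show "K * d \<le> 1 / 2" using K by (simp add: field_simps)
  qed
  define M where "M = 2 powr \<alpha> * (gen_A \<alpha> + gen_B \<alpha>) powr \<alpha>"
  define C where "C = 2 * K + 1 / d\<^sup>2 + M / d powr (2 + \<alpha>)"
  have M: "M \<ge> 0" by (simp add: M_def)
  have parts: "2 * K \<le> C" "1 / d\<^sup>2 + M / d powr (2 + \<alpha>) \<le> C"
    using K M d by (simp_all add: C_def)
  show ?thesis
  proof (rule that)
    show "C \<ge> 0" using parts(1) K by simp
    fix x :: real
    show "norm ((- \<i> * of_real x) powr of_real \<alpha> * exp (- \<i> * of_real x / 2)
           - gen_fun \<alpha> (exp (\<i> * of_real x))) \<le> C * \<bar>x\<bar> powr (2 + \<alpha>)" (is "norm ?E \<le> _")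
    proof (cases "\<bar>x\<bar> \<le> d")
      case True
      have "norm ?E \<le> 2 * K * \<bar>x\<bar> powr (2 + \<alpha>)"
        unfolding K_def B_def
      proof (rule symbol_estimate_near_0[OF assms])
        show "\<bar>x\<bar> \<le> 1 / 2" using True d by simp
        show "gen_B \<alpha> * \<bar>x\<bar> \<le> 1 / 2"
          using mult_left_mono[OF True, of B] B d(3) unfolding B_def by linarith
        have "x\<^sup>2 = \<bar>x\<bar> * \<bar>x\<bar>" by (simp add: power2_eq_square)
        also have "\<dots> \<le> 1 * d" using True d by (intro mult_mono) auto
        finally have "K * x\<^sup>2 \<le> K * d" using K by (intro mult_left_mono) auto
        then show "\<alpha> * (3 + gen_B \<alpha> + 2 * (gen_B \<alpha>)\<^sup>2) * x\<^sup>2 \<le> 1 / 2"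
          using d(4) unfolding K_def B_def by linarith
      qed
      also have "\<dots> \<le> C * \<bar>x\<bar> powr (2 + \<alpha>)" by (intro mult_right_mono parts) simp
      finally show ?thesis .
    next
      case False
      then have x: "\<bar>x\<bar> > d" "\<bar>x\<bar> > 0" using d by auto
      have "norm ?E \<le> norm ((- \<i> * of_real x) powr of_real \<alpha> * exp (- \<i> * of_real x / 2))
          + norm (gen_fun \<alpha> (exp (\<i> * of_real x)))"
        by (rule norm_triangle_ineq4)
      also have "\<dots> \<le> \<bar>x\<bar> powr \<alpha> + M"
        using norm_gen_fun_le[OF assms, of "exp (\<i> * of_real x)"]
        by (simp add: norm_mult norm_powr_real_powr' M_def)
      also have "\<dots> \<le> 1 / d\<^sup>2 * \<bar>x\<bar> powr (2 + \<alpha>) + M / d powr (2 + \<alpha>) * \<bar>x\<bar> powr (2 + \<alpha>)"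
      proof (rule add_mono)
        have "d\<^sup>2 \<le> \<bar>x\<bar>\<^sup>2" using x d by (intro power_mono) auto
        then have "d\<^sup>2 * \<bar>x\<bar> powr \<alpha> \<le> \<bar>x\<bar>\<^sup>2 * \<bar>x\<bar> powr \<alpha>" by (intro mult_right_mono) auto
        also have "\<dots> = \<bar>x\<bar> powr (2 + \<alpha>)" using x by (simp add: powr_add powr_numeral)
        finally show "\<bar>x\<bar> powr \<alpha> \<le> 1 / d\<^sup>2 * \<bar>x\<bar> powr (2 + \<alpha>)" using d by (simp add: field_simps)
        have "d powr (2 + \<alpha>) \<le> \<bar>x\<bar> powr (2 + \<alpha>)" using x d assms by (intro powr_mono2) auto
        then have "M * d powr (2 + \<alpha>) \<le> M * \<bar>x\<bar> powr (2 + \<alpha>)" using M by (intro mult_left_mono)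
        then show "M \<le> M / d powr (2 + \<alpha>) * \<bar>x\<bar> powr (2 + \<alpha>)" using d by (simp add: field_simps)
      qed
      also have "\<dots> = (1 / d\<^sup>2 + M / d powr (2 + \<alpha>)) * \<bar>x\<bar> powr (2 + \<alpha>)"
        by (simp add: ring_distribs)
      also have "\<dots> \<le> C * \<bar>x\<bar> powr (2 + \<alpha>)" by (intro mult_right_mono parts) simp
      finally show ?thesis .
    qed
  qed
qed

section \<open>Fourier inversion\<close>

lemma integrable_lborel_product:
  fixes f g :: "real \<Rightarrow> complex"
  assumes [measurable]: "integrable lborel f" "integrable lborel g"
  shows "integrable (lborel \<Otimes>\<^sub>M lborel) (\<lambda>(x, y). f x * g y)"
proof (rule lborel_pair.Fubini_integrable)
  show "(\<lambda>(x, y). f x * g y) \<in> borel_measurable (lborel \<Otimes>\<^sub>M lborel)"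
    by measurable
  show "integrable lborel (\<lambda>x. LINT y|lborel. norm (case (x, y) of (x, y) \<Rightarrow> f x * g y))"
    using assms by (simp add: norm_mult)
  show "AE x in lborel. integrable lborel (\<lambda>y. case (x, y) of (x, y) \<Rightarrow> f x * g y)"
    using assms by simp
qed

text \<open>Since \<open>k\<close> has modulus at most 1, the integrable product
  \<open>f x * g y\<close> dominates and Fubini applies. With \<open>k\<close> an exponential this
  moves a Fourier integral from one factor to the other.\<close>

lemma fubini_multiplier:
  fixes f g :: "real \<Rightarrow> complex" and k :: "real \<Rightarrow> real \<Rightarrow> complex"
  assumes "integrable lborel f" "integrable lborel g"
    and k: "case_prod k \<in> borel_measurable (lborel \<Otimes>\<^sub>M lborel)" "\<And>x y. norm (k x y) \<le> 1"
  shows "(LINT x|lborel. f x * (LINT y|lborel. k x y * g y))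
       = (LINT y|lborel. g y * (LINT x|lborel. k x y * f x))"
proof -
  note [measurable] = assms(1-2) k(1)
  have "integrable (lborel \<Otimes>\<^sub>M lborel) (\<lambda>(x, y). k x y * (f x * g y))"
  proof (rule Bochner_Integration.integrable_bound[OF integrable_lborel_product[OF assms(1,2)]])
    have "(\<lambda>z. case_prod k z * (f (fst z) * g (snd z))) \<in> borel_measurable (lborel \<Otimes>\<^sub>M lborel)"
      by measurable
    then show "(\<lambda>(x, y). k x y * (f x * g y)) \<in> borel_measurable (lborel \<Otimes>\<^sub>M lborel)"
      by (simp add: case_prod_beta')
    show "AE z in lborel \<Otimes>\<^sub>M lborel. norm (case z of (x, y) \<Rightarrow> k x y * (f x * g y))
            \<le> norm (case z of (x, y) \<Rightarrow> f x * g y)"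
      using k(2) by (auto simp: norm_mult mult_left_le_one_le)
  qed
  from lborel_pair.Fubini_integral[OF this]
  have "(LINT y|lborel. LINT x|lborel. k x y * (f x * g y))
      = (LINT x|lborel. LINT y|lborel. k x y * (f x * g y))" .
  moreover have "(LINT x|lborel. k x y * (f x * g y)) = g y * (LINT x|lborel. k x y * f x)" for y
    by (subst integral_mult_right_zero[symmetric], rule Bochner_Integration.integral_cong)
       (simp_all add: mult_ac)
  moreover have "(LINT y|lborel. k x y * (f x * g y)) = f x * (LINT y|lborel. k x y * g y)" for x
    by (subst integral_mult_right_zero[symmetric], rule Bochner_Integration.integral_cong)
       (simp_all add: mult_ac)
  ultimately show ?thesis by simp
qed

lemma borel_measurable_fourier:
  assumes [measurable]: "integrable lborel u"
  shows "fourier u \<in> borel_measurable borel"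
  unfolding fourier_def by measurable

lemma norm_fourier_le: "norm (fourier u \<omega>) \<le> (LINT t|lborel. norm (u t))"
proof -
  have "norm (fourier u \<omega>) \<le> (LINT t|lborel. norm (exp (\<i> * of_real (\<omega> * t)) * u t))"
    unfolding fourier_def by (rule integral_norm_bound)
  then show ?thesis by (simp add: norm_mult)
qed

section \<open>Gaussian kernels and Fourier inversion\<close>

lemma std_normal_density_le_1: "std_normal_density y \<le> 1"
proof -
  have "1 \<le> sqrt (2 * pi)"
    using pi_ge_two by (intro real_le_rsqrt) (simp add: power2_eq_square)
  moreover have "exp (- (y\<^sup>2 / 2)) \<le> 1" by simp
  ultimately have "exp (- (y\<^sup>2 / 2)) \<le> sqrt (2 * pi)" by linarith
  then show ?thesis unfolding std_normal_density_def by (simp add: field_simps)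
qed

text \<open>At \<open>y = (n + 1) |x|\<close>, the product of \<open>y\<close> and the density is at
  most \<open>1 / y\<close> and at most 1. Dividing by \<open>|x|\<close>, the first bound gives the
  limit and the second a majorant free of \<open>n\<close>.\<close>

lemma std_normal_density_tail:
  assumes "x \<noteq> 0"
  shows "(\<lambda>n. real (Suc n) * std_normal_density (real (Suc n) * x)) \<longlonglongrightarrow> 0"
    and "real (Suc n) * std_normal_density (real (Suc n) * x) \<le> 1 / \<bar>x\<bar>"
proof -
  have *: "y * std_normal_density y \<le> 1 / y" if "y > 0" for y :: real
  proof -
    have "y\<^sup>2 / 2 < exp (y\<^sup>2 / 2)"
      using exp_ge_add_one_self[of "y\<^sup>2 / 2"] by linarith
    then have "y\<^sup>2 * exp (- (y\<^sup>2 / 2)) \<le> 2"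
      by (simp add: exp_minus field_simps)
    moreover have "2 \<le> sqrt (2 * pi)"
      using pi_ge_two by (intro real_le_rsqrt) (simp add: power2_eq_square)
    ultimately have "y\<^sup>2 * exp (- (y\<^sup>2 / 2)) / sqrt (2 * pi) \<le> 1"
      by (simp add: field_simps)
    then show ?thesis
      using that by (simp add: std_normal_density_def field_simps power2_eq_square)
  qed
  have sym: "std_normal_density (real (Suc n) * x) = std_normal_density (real (Suc n) * \<bar>x\<bar>)" for n
    by (simp add: std_normal_density_def power_mult_distrib)
  have b: "real (Suc n) * std_normal_density (real (Suc n) * x) \<le> 1 / (real (Suc n) * x\<^sup>2)" for n
  proof -
    have "real (Suc n) * \<bar>x\<bar> * std_normal_density (real (Suc n) * \<bar>x\<bar>) \<le> 1 / (real (Suc n) * \<bar>x\<bar>)"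
      using assms by (intro *) simp
    then have "real (Suc n) * \<bar>x\<bar> * std_normal_density (real (Suc n) * \<bar>x\<bar>) / \<bar>x\<bar>
        \<le> 1 / (real (Suc n) * \<bar>x\<bar>) / \<bar>x\<bar>"
      by (rule divide_right_mono) simp
    then show ?thesis unfolding sym using assms
      by (simp add: power2_eq_square mult.assoc del: of_nat_Suc)
  qed
  show "(\<lambda>n. real (Suc n) * std_normal_density (real (Suc n) * x)) \<longlonglongrightarrow> 0"
  proof (rule tendsto_sandwich[OF _ _ tendsto_const])
    show "(\<lambda>n. 1 / (real (Suc n) * x\<^sup>2)) \<longlonglongrightarrow> 0"
      using tendsto_mult[OF LIMSEQ_inverse_real_of_nat tendsto_const[of "1 / x\<^sup>2"]]
      by (simp add: field_simps del: of_nat_Suc)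
  qed (use b in \<open>auto intro!: always_eventually simp del: of_nat_Suc\<close>)
  have "y * std_normal_density y \<le> 1" if "y > 0" for y :: real
  proof (cases "y \<le> 1")
    case True
    with std_normal_density_le_1[of y] that show ?thesis by (intro mult_le_one) auto
  next
    case False
    with * [of y] that show ?thesis by (smt (verit) divide_le_eq_1_pos)
  qed
  from this[of "real (Suc n) * \<bar>x\<bar>"] show "real (Suc n) * std_normal_density (real (Suc n) * x) \<le> 1 / \<bar>x\<bar>"
    unfolding sym using assms by (simp add: field_simps del: of_nat_Suc)
qed

text \<open>This is the characteristic function of the standard normal distribution.\<close>

lemma integral_exp_gaussian:
  fixes x :: real
  shows "(LINT y|lborel. exp (\<i> * of_real (y * x)) * complex_of_real (std_normal_density y))
       = of_real (exp (- x\<^sup>2 / 2))"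
proof -
  have "char std_normal_distribution x
      = (LINT y|lborel. std_normal_density y *\<^sub>R exp (\<i> * of_real (x * y)))"
    unfolding char_def by (subst integral_density) (auto simp: mult.commute)
  then show ?thesis
    by (simp add: char_std_normal_distribution scaleR_conv_of_real mult_ac)
qed

text \<open>The Gaussian kernels concentrate at \<open>t\<close>. Since \<open>u\<close> need not be bounded, dominated
  convergence is used separately near \<open>t\<close>, after rescaling, and away from \<open>t\<close>.\<close>

lemma gaussian_approx_identity:
  fixes u :: "real \<Rightarrow> complex"
  assumes cont: "continuous_on UNIV u" and int: "integrable lborel u"
  shows "(\<lambda>n. LINT s|lborel. u s * of_real (real (Suc n) * std_normal_density (real (Suc n) * (s - t))))
           \<longlonglongrightarrow> u t"
proof -
  note [measurable] = borel_measurable_continuous_onI[OF cont]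
  let ?k = "\<lambda>n x. real (Suc n) * std_normal_density (real (Suc n) * x)"
  have "isCont u t" using cont continuous_on_eq_continuous_at by blast
  then obtain d where d: "d > 0" "\<And>x. \<bar>x - t\<bar> < d \<Longrightarrow> norm (u x - u t) < 1"
    unfolding continuous_at_eps_delta by (auto simp: dist_norm dest: spec[of _ 1])
  have near_bound: "norm (u x) \<le> norm (u t) + 1" if "\<bar>x - t\<bar> < d" for x
    using d(2)[OF that] norm_triangle_ineq2[of "u x" "u t"] by linarith
  define A where "A = (\<lambda>x. indicator {t - d<..<t + d} x * u x)"
  define B where "B = (\<lambda>x. indicator (- {t - d<..<t + d}) x * u x)"
  have [measurable]: "A \<in> borel_measurable borel" "B \<in> borel_measurable borel"
    unfolding A_def B_def by measurable
  have intA: "integrable lborel A" and intB: "integrable lborel B"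
    by (rule Bochner_Integration.integrable_bound[OF int];
        auto simp: A_def B_def indicator_def)+
  have uAB: "u s = A s + B s" for s by (auto simp: A_def B_def indicator_def)
  have kbound: "\<bar>?k n x\<bar> \<le> real (Suc n)" for n x
    using std_normal_density_le_1 by (simp add: abs_mult mult_left_le del: of_nat_Suc)
  have intk: "integrable lborel (\<lambda>s. f s * of_real (?k n (s - t)))"
    if "integrable lborel f" for f :: "real \<Rightarrow> complex" and n
  proof (rule Bochner_Integration.integrable_bound[OF integrable_mult_right[OF integrable_norm[OF that]]])
    show "AE s in lborel. norm (f s * complex_of_real (?k n (s - t))) \<le> norm (real (Suc n) * norm (f s))"
    proof (rule AE_I2)
      fix s
      have "norm (f s) * \<bar>?k n (s - t)\<bar> \<le> norm (f s) * real (Suc n)"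
        by (rule mult_left_mono[OF kbound]) simp
      then show "norm (f s * complex_of_real (?k n (s - t))) \<le> norm (real (Suc n) * norm (f s))"
        by (simp add: norm_mult abs_mult mult.commute del: of_nat_Suc)
    qed
  qed (use that in measurable)
  \<comment> \<open>Substituting \<open>s = t + y / (n + 1)\<close> fixes the Gaussian while the
    argument of \<open>A\<close> tends to \<open>t\<close>; the choice of \<open>d\<close> bounds
    \<open>A\<close> by \<open>norm (u t) + 1\<close>.\<close>
  have "(\<lambda>n. LINT y|lborel. A (t + y / real (Suc n)) * of_real (std_normal_density y)) \<longlonglongrightarrow>
          (LINT y|lborel. u t * of_real (std_normal_density y))"
  proof (rule integral_dominated_convergence[where w = "\<lambda>y. (norm (u t) + 1) * std_normal_density y"])
    show "AE y in lborel. (\<lambda>n. A (t + y / real (Suc n)) * of_real (std_normal_density y))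
             \<longlonglongrightarrow> u t * of_real (std_normal_density y)"
    proof (rule AE_I2, rule tendsto_mult_right)
      fix y :: real
      have l: "(\<lambda>n. t + y / real (Suc n)) \<longlonglongrightarrow> t"
        using tendsto_add[OF tendsto_const tendsto_mult[OF tendsto_const LIMSEQ_inverse_real_of_nat], of t y]
        by (simp add: field_simps del: of_nat_Suc)
      have "(\<lambda>n. u (t + y / real (Suc n))) \<longlonglongrightarrow> u t"
        using isCont_tendsto_compose[OF \<open>isCont u t\<close> l] .
      moreover have "eventually (\<lambda>n. u (t + y / real (Suc n)) = A (t + y / real (Suc n))) sequentially"
        using topological_tendstoD[OF l, of "{t - d<..<t + d}"] d(1)
        by (auto elim!: eventually_mono simp: A_def simp del: of_nat_Suc)
      ultimately show "(\<lambda>n. A (t + y / real (Suc n))) \<longlonglongrightarrow> u t"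
        by (rule Lim_transform_eventually)
    qed
    show "AE y in lborel. norm (A (t + y / real (Suc n)) * of_real (std_normal_density y))
            \<le> (norm (u t) + 1) * std_normal_density y" for n
      using near_bound by (auto simp: norm_mult A_def indicator_def intro!: mult_right_mono simp del: of_nat_Suc)
  qed (auto intro!: integrable_mult_right integrable_normal_density)
  moreover have "(LINT y|lborel. u t * of_real (std_normal_density y)) = u t"
    by (simp add: integral_normal_density)
  moreover have "(LINT y|lborel. A (t + y / real (Suc n)) * of_real (std_normal_density y))
      = (LINT s|lborel. A s * of_real (?k n (s - t)))" for n
    by (subst (2) lborel_integral_real_affine[where c = "1 / real (Suc n)" and t = t])
       (auto simp: scaleR_conv_of_real simp flip: integral_mult_right_zero simp del: of_nat_Suc
         intro!: Bochner_Integration.integral_cong)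
  ultimately have limA: "(\<lambda>n. LINT s|lborel. A s * of_real (?k n (s - t))) \<longlonglongrightarrow> u t" by simp
  \<comment> \<open>Where \<open>B\<close> is nonzero, \<open>|s - t| \<ge> d\<close>, so there the
    kernels are at most \<open>1 / d\<close> and tend to 0.\<close>
  have "(\<lambda>n. LINT s|lborel. B s * of_real (?k n (s - t))) \<longlonglongrightarrow> (LINT s|(lborel :: real measure). (0::complex))"
  proof (rule integral_dominated_convergence[where w = "\<lambda>s. norm (B s) * (1 / d)"])
    show "AE s in lborel. (\<lambda>n. B s * of_real (?k n (s - t))) \<longlonglongrightarrow> 0"
    proof (rule AE_I2)
      fix s show "(\<lambda>n. B s * of_real (?k n (s - t))) \<longlonglongrightarrow> 0"
      proof (cases "s = t")
        case True
        then have "B s = 0" using d by (simp add: B_def)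
        then show ?thesis by simp
      next
        case False
        then show ?thesis
          using tendsto_mult[OF tendsto_const tendsto_of_real[OF std_normal_density_tail(1)[of "s - t"]], of "B s"]
          by simp
      qed
    qed
    show "AE s in lborel. norm (B s * of_real (?k n (s - t))) \<le> norm (B s) * (1 / d)" for n
    proof (rule AE_I2)
      fix s show "norm (B s * of_real (?k n (s - t))) \<le> norm (B s) * (1 / d)"
      proof (cases "B s = 0")
        case False
        then have "\<bar>s - t\<bar> \<ge> d" by (auto simp: B_def indicator_def split: if_splits)
        moreover from this d have "?k n (s - t) \<le> 1 / \<bar>s - t\<bar>"
          by (intro std_normal_density_tail(2)) auto
        ultimately have "?k n (s - t) \<le> 1 / d"
          using d(1) by (smt (verit) frac_le)
        then show ?thesis unfolding norm_mult
          by (intro mult_left_mono) (auto simp: abs_mult simp del: of_nat_Suc of_real_mult)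
      qed simp
    qed
  qed (use intB in auto)
  then have limB: "(\<lambda>n. LINT s|lborel. B s * of_real (?k n (s - t))) \<longlonglongrightarrow> 0" by simp
  have "(LINT s|lborel. u s * of_real (?k n (s - t)))
      = (LINT s|lborel. A s * of_real (?k n (s - t))) + (LINT s|lborel. B s * of_real (?k n (s - t)))" for n
    unfolding uAB distrib_right by (rule Bochner_Integration.integral_add[OF intk[OF intA] intk[OF intB]])
  with tendsto_add[OF limA limB] show ?thesis by (simp del: of_nat_Suc)
qed

text \<open>Gaussian summation: a Gaussian factor in \<open>\<omega> / (n + 1)\<close> is inserted
  into the inverse integral, and the limit is computed twice. Integrability of
  \<open>fourier u\<close> lets the factor disappear; after Fubini the same integral is
  \<open>2 * pi\<close> times a Gaussian average of \<open>u\<close> around \<open>t\<close>.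
  Continuity gives equality at every point.\<close>

theorem fourier_inversion:
  fixes u :: "real \<Rightarrow> complex"
  assumes cont: "continuous_on UNIV u" and int: "integrable lborel u"
    and intF: "integrable lborel (fourier u)"
  shows "u t = 1 / (2 * pi) * (LINT \<omega>|lborel. exp (- \<i> * of_real (\<omega> * t)) * fourier u \<omega>)"
proof -
  note [measurable] = borel_measurable_continuous_onI[OF cont] borel_measurable_fourier[OF int]
  let ?g = "\<lambda>n \<omega>. exp (- (\<omega> / real (Suc n))\<^sup>2 / 2)"
  let ?I = "\<lambda>n. LINT \<omega>|lborel. (exp (- \<i> * of_real (\<omega> * t)) * of_real (?g n \<omega>)) * fourier u \<omega>"
  have gint: "integrable lborel (?g n)" for n
  proof -
    have "integrable lborel (\<lambda>\<omega>. std_normal_density (0 + (1 / real (Suc n)) * \<omega>))"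
      by (rule lborel_integrable_real_affine) (auto intro: integrable_normal_density)
    from integrable_mult_right[OF this, of "sqrt (2 * pi)"] show ?thesis
      by (simp add: std_normal_density_def del: of_nat_Suc)
  qed
  have lim1: "?I \<longlonglongrightarrow> (LINT \<omega>|lborel. exp (- \<i> * of_real (\<omega> * t)) * fourier u \<omega>)"
  proof (rule integral_dominated_convergence[where w = "\<lambda>\<omega>. norm (fourier u \<omega>)"])
    show "AE \<omega> in lborel. (\<lambda>n. exp (- \<i> * of_real (\<omega> * t)) * of_real (?g n \<omega>) * fourier u \<omega>)
            \<longlonglongrightarrow> exp (- \<i> * of_real (\<omega> * t)) * fourier u \<omega>"
    proof (rule AE_I2)
      fix \<omega> :: real
      have "(\<lambda>n. \<omega> / real (Suc n)) \<longlonglongrightarrow> 0"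
        using tendsto_mult[OF tendsto_const LIMSEQ_inverse_real_of_nat, of \<omega>]
        by (simp add: field_simps del: of_nat_Suc)
      then have "(\<lambda>n. of_real (?g n \<omega>) :: complex) \<longlonglongrightarrow> of_real (exp (- 0\<^sup>2 / 2))"
        by (intro tendsto_intros) simp_all
      then have "(\<lambda>n. of_real (?g n \<omega>) :: complex) \<longlonglongrightarrow> 1" by simp
      then have "(\<lambda>n. exp (- \<i> * of_real (\<omega> * t)) * of_real (?g n \<omega>) * fourier u \<omega>)
            \<longlonglongrightarrow> exp (- \<i> * of_real (\<omega> * t)) * 1 * fourier u \<omega>"
        by (intro tendsto_mult tendsto_const)
      then show "(\<lambda>n. exp (- \<i> * of_real (\<omega> * t)) * of_real (?g n \<omega>) * fourier u \<omega>)
            \<longlonglongrightarrow> exp (- \<i> * of_real (\<omega> * t)) * fourier u \<omega>" by simp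
    qed
    show "AE \<omega> in lborel. norm (exp (- \<i> * of_real (\<omega> * t)) * of_real (?g n \<omega>) * fourier u \<omega>)
            \<le> norm (fourier u \<omega>)" for n
      by (auto simp: norm_mult intro!: mult_left_le_one_le)
  qed (use intF in auto)
  have I: "?I n = 2 * pi * (LINT s|lborel. u s * of_real (real (Suc n) * std_normal_density (real (Suc n) * (s - t))))"
    for n
  proof -
    let ?f = "\<lambda>\<omega>. exp (- \<i> * of_real (\<omega> * t)) * complex_of_real (?g n \<omega>)"
    have intf: "integrable lborel ?f"
      by (rule Bochner_Integration.integrable_bound[OF gint[of n]]) (auto simp: norm_mult)
    have outer: "?I n = (LINT s|lborel. u s * (LINT \<omega>|lborel. exp (\<i> * of_real (\<omega> * s)) * ?f \<omega>))"
      unfolding fourier_def by (rule fubini_multiplier[OF intf int]) simp_all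
    \<comment> \<open>A Gaussian of width \<open>n + 1\<close> in frequency becomes one of width
      \<open>1 / (n + 1)\<close> in time; \<open>sqrt (2 * pi)\<close> is \<open>2 * pi\<close>
      times the normalising factor of the density.\<close>
    have inner: "(LINT \<omega>|lborel. exp (\<i> * of_real (\<omega> * s)) * ?f \<omega>)
        = 2 * pi * of_real (real (Suc n) * std_normal_density (real (Suc n) * (s - t)))" for s
    proof -
      have "(LINT \<omega>|lborel. exp (\<i> * of_real (\<omega> * s)) * ?f \<omega>)
         = real (Suc n) * (LINT y|lborel. exp (\<i> * of_real (real (Suc n) * y * s)) * ?f (real (Suc n) * y))"
        by (subst lborel_integral_real_affine[where c = "real (Suc n)" and t = 0])
           (simp_all add: scaleR_conv_of_real del: of_nat_Suc)
      also have "(LINT y|lborel. exp (\<i> * of_real (real (Suc n) * y * s)) * ?f (real (Suc n) * y))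
         = (LINT y|lborel. sqrt (2 * pi) * (exp (\<i> * of_real (y * (real (Suc n) * (s - t)))) * complex_of_real (std_normal_density y)))"
        by (rule Bochner_Integration.integral_cong)
           (simp_all add: std_normal_density_def algebra_simps flip: exp_add del: of_nat_Suc)
      also have "\<dots> = complex_of_real (sqrt (2 * pi)) * of_real (exp (- (real (Suc n) * (s - t))\<^sup>2 / 2))"
        by (simp only: integral_mult_right_zero integral_exp_gaussian)
      also have "\<dots> = of_real (2 * pi * std_normal_density (real (Suc n) * (s - t)))"
      proof -
        have "sqrt (2 * pi) = 2 * pi * (1 / sqrt (2 * pi))"
          by (simp add: real_div_sqrt)
        then show ?thesis unfolding std_normal_density_def
          by (metis mult.assoc of_real_mult)
      qed
      finally show ?thesis by (simp add: mult_ac del: of_nat_Suc)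
    qed
    show ?thesis
      unfolding outer inner integral_mult_right_zero[symmetric] by (simp only: of_real_mult id_apply of_real_eq_id mult_ac)
  qed
  have "?I \<longlonglongrightarrow> 2 * pi * u t"
    unfolding I by (intro tendsto_mult tendsto_const gaussian_approx_identity cont int)
  from LIMSEQ_unique[OF lim1 this] show ?thesis by simp
qed

section \<open>The Laplace transform of a power\<close>

lemma has_vector_derivative_iff_tendsto:
  fixes f :: "real \<Rightarrow> 'a :: real_normed_vector"
  shows "(f has_vector_derivative D) (at t) \<longleftrightarrow>
    ((\<lambda>s. (1 / (s - t)) *\<^sub>R (f s - f t)) \<longlongrightarrow> D) (at t)"
proof -
  have "eventually (\<lambda>s. norm ((1 / norm (s - t)) *\<^sub>R (f s - (f t + (s - t) *\<^sub>R D)))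
      = norm ((1 / (s - t)) *\<^sub>R (f s - f t) - D)) (at t)"
  proof (intro eventually_at_filter[THEN iffD2] always_eventually allI impI)
    fix s assume "s \<noteq> t"
    then have "(1 / (s - t)) *\<^sub>R (f s - f t) - D = (1 / (s - t)) *\<^sub>R (f s - (f t + (s - t) *\<^sub>R D))"
      by (simp add: scaleR_diff_right scaleR_add_right)
    then show "norm ((1 / norm (s - t)) *\<^sub>R (f s - (f t + (s - t) *\<^sub>R D)))
      = norm ((1 / (s - t)) *\<^sub>R (f s - f t) - D)" by simp
  qed
  from tendsto_cong[OF this, of 0] show ?thesis
    unfolding has_vector_derivative_def has_derivative_within Lim_null[of _ D] tendsto_norm_zero_iff
    by (simp add: bounded_linear_scaleR_left)
qed

text \<open>By the mean value inequality \<open>w\<close> bounds every difference quotient, so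
  dominated convergence applies along any sequence tending to \<open>t\<close>.\<close>

lemma has_vector_derivative_lebesgue_integral:
  fixes f :: "real \<Rightarrow> 'a \<Rightarrow> complex"
  assumes int: "\<And>t. integrable M (f t)"
    and deriv: "\<And>t x. x \<in> space M \<Longrightarrow> ((\<lambda>t. f t x) has_vector_derivative f' t x) (at t)"
    and bound: "\<And>t x. x \<in> space M \<Longrightarrow> norm (f' t x) \<le> w x"
    and w: "integrable M w"
  shows "((\<lambda>t. LINT x|M. f t x) has_vector_derivative (LINT x|M. f' t x)) (at t)"
proof -
  have lip: "norm (f s x - f t x) \<le> w x * norm (s - t)" if "x \<in> space M" for s t x
  proof (rule differentiable_bound[OF convex_UNIV])
    fix r
    show "((\<lambda>t. f t x) has_derivative (\<lambda>h. h *\<^sub>R f' r x)) (at r within UNIV)"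
      using deriv[OF that] by (simp add: has_vector_derivative_def)
    show "onorm (\<lambda>h. h *\<^sub>R f' r x) \<le> w x"
      using bound[OF that] by (simp add: onorm_scaleR_left_lemma onorm_scaleR_left onorm_id)
  qed auto
  have "((\<lambda>s. (1 / (s - t)) *\<^sub>R ((LINT x|M. f s x) - (LINT x|M. f t x))) \<longlongrightarrow> (LINT x|M. f' t x)) (at t)"
    unfolding tendsto_at_iff_sequentially
  proof (intro allI impI)
    fix X :: "nat \<Rightarrow> real" assume X: "\<forall>i. X i \<in> UNIV - {t}" "X \<longlonglongrightarrow> t"
    let ?q = "\<lambda>n x. (1 / (X n - t)) *\<^sub>R (f (X n) x - f t x)"
    have lim: "(\<lambda>n. ?q n x) \<longlonglongrightarrow> f' t x" if "x \<in> space M" for x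
    proof -
      have "((\<lambda>s. (1 / (s - t)) *\<^sub>R (f s x - f t x)) \<longlongrightarrow> f' t x) (at t)"
        using deriv[OF that, of t] by (simp add: has_vector_derivative_iff_tendsto)
      with X show ?thesis unfolding tendsto_at_iff_sequentially o_def by blast
    qed
    have "(\<lambda>n. LINT x|M. ?q n x) \<longlonglongrightarrow> (LINT x|M. f' t x)"
    proof (rule integral_dominated_convergence[OF _ _ w])
      show qm: "?q n \<in> borel_measurable M" for n
        using int by (intro borel_measurable_scaleR borel_measurable_diff) auto
      \<comment> \<open>Measurability is inherited from the difference quotients, whose pointwise
        limit is \<open>f' t\<close>.\<close>
      show "f' t \<in> borel_measurable M"
        using lim qm by (rule borel_measurable_LIMSEQ_metric[rotated])
      show "AE x in M. norm (?q n x) \<le> w x" for n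
      proof (rule AE_I2)
        fix x assume "x \<in> space M"
        from lip[OF this, of "X n" t] X(1) show "norm (?q n x) \<le> w x"
          by (simp add: divide_le_eq flip: divide_inverse scaleR_diff_right)
      qed
    qed (use lim in auto)
    then show "((\<lambda>s. (1 / (s - t)) *\<^sub>R ((LINT x|M. f s x) - (LINT x|M. f t x))) \<circ> X) \<longlonglongrightarrow> (LINT x|M. f' t x)"
      using int by (simp add: o_def)
  qed
  then show ?thesis by (simp add: has_vector_derivative_iff_tendsto)
qed

section \<open>Gamma integrals with a complex parameter\<close>

lemma has_bochner_integral_Gamma_scaled:
  fixes b c :: real
  assumes "b > 0" "c > 0"
  shows "has_bochner_integral lborel (\<lambda>r. indicator {0<..} r * (r powr (b - 1) * exp (- c * r)))
           (Gamma b * c powr (- b))"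
proof -
  let ?f = "\<lambda>r::real. indicator {0<..} r * (r powr (b - 1) * exp (- r))"
  have "(\<integral>\<^sup>+x. ennreal (?f x) \<partial>lborel) = ennreal (Gamma b)"
  proof -
    have "(\<integral>\<^sup>+x. ennreal (?f x) \<partial>lborel) = (\<integral>\<^sup>+t. ennreal (indicator {0..} t * t powr (b - 1) / exp t) \<partial>lborel)"
      by (rule nn_integral_cong_AE, rule AE_I[where N = "{0}"])
         (auto simp: indicator_def exp_minus field_simps split: if_splits)
    then show ?thesis using Gamma_conv_nn_integral_real[OF \<open>b > 0\<close>] by simp
  qed
  then have "has_bochner_integral lborel ?f (Gamma b)"
    using \<open>b > 0\<close> by (intro has_bochner_integral_nn_integral) (auto simp: indicator_def)
  then have "has_bochner_integral lborel (\<lambda>r. ?f (0 + c * r)) (Gamma b /\<^sub>R \<bar>c\<bar>)"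
    using \<open>c > 0\<close> by (subst lborel_has_bochner_integral_real_affine_iff[symmetric]) auto
  then have *: "has_bochner_integral lborel (\<lambda>r. c powr (1 - b) * ?f (0 + c * r)) (c powr (1 - b) * (Gamma b /\<^sub>R \<bar>c\<bar>))"
    by (intro has_bochner_integral_mult_right) simp
  have 1: "c powr (1 - b) * ?f (0 + c * r) = indicator {0<..} r * (r powr (b - 1) * exp (- c * r))" for r
  proof (cases "r > 0")
    case True
    have "c powr (1 - b) * c powr (b - 1) = 1"
      using \<open>c > 0\<close> by (simp flip: powr_add)
    with True \<open>c > 0\<close> show ?thesis by (simp add: powr_mult flip: mult.assoc)
  next
    case False
    with \<open>c > 0\<close> show ?thesis by (simp add: zero_less_mult_iff)
  qed
  have 2: "c powr (1 - b) * (Gamma b /\<^sub>R \<bar>c\<bar>) = Gamma b * c powr (- b)"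
    using \<open>c > 0\<close> by (simp add: powr_diff powr_minus divide_simps)
  show ?thesis using * unfolding 1 2 .
qed

text \<open>The integrand of the Laplace transform of a power. With \<open>b = 1 - \<alpha>\<close>
  and \<open>s\<close> real and positive it is the damped Riemann-Liouville kernel; the imaginary
  part of \<open>s\<close> carries the frequency.\<close>

definition gamma_kernel :: "real \<Rightarrow> complex \<Rightarrow> real \<Rightarrow> complex" where
  "gamma_kernel b s r = indicator {0<..} r * (of_real (r powr (b - 1)) * exp (- s * of_real r))"

lemma gamma_kernel_measurable [measurable]: "gamma_kernel b s \<in> borel_measurable borel"
  unfolding gamma_kernel_def by measurable

lemma norm_gamma_kernel:
  "norm (gamma_kernel b s r) = indicator {0<..} r * (r powr (b - 1) * exp (- Re s * r))"
  by (simp add: gamma_kernel_def norm_mult indicator_def)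

lemma integrable_gamma_kernel:
  assumes "b > 0" "Re s > 0"
  shows "integrable lborel (gamma_kernel b s)"
proof (rule Bochner_Integration.integrable_bound)
  show "integrable lborel (\<lambda>r. indicator {0<..} r * (r powr (b - 1) * exp (- Re s * r)))"
    using has_bochner_integral_Gamma_scaled[OF assms] by (rule integrable.intros)
qed (auto simp: norm_gamma_kernel)

text \<open>The boundary terms of \<open>r^b e^(-sr)\<close> vanish, at 0 because
  \<open>b > 0\<close> and at infinity because \<open>Re s > 0\<close>.\<close>

lemma gamma_kernel_by_parts:
  assumes "b > 0" "Re s > 0"
  shows "s * (LINT r|lborel. gamma_kernel (b + 1) s r) = b * (LINT r|lborel. gamma_kernel b s r)"
proof -
  let ?F = "\<lambda>r. of_real (r powr b) * exp (- s * of_real r)"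
  let ?f = "\<lambda>r. of_real b * (of_real (r powr (b - 1)) * exp (- s * of_real r))
      - s * (of_real (r powr b) * exp (- s * of_real r))"
  have eq: "indicator {0<..} r *\<^sub>R ?f r = of_real b * gamma_kernel b s r - s * gamma_kernel (b + 1) s r" for r
    by (simp add: gamma_kernel_def indicator_def)
  have int: "integrable lborel (\<lambda>r. of_real b * gamma_kernel b s r)"
     "integrable lborel (\<lambda>r. s * gamma_kernel (b + 1) s r)"
    using assms by (auto intro!: integrable_mult_right integrable_gamma_kernel)
  have "(LBINT r=0..\<infinity>. ?f r) = 0 - 0"
  proof (rule interval_integral_FTC_integrable[where F = ?F])
    fix x :: real assume "0 < ereal x"
    then have x: "x > 0" by simp
    have "((\<lambda>r. r powr b) has_real_derivative b * x powr (b - 1)) (at x)"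
      using x by (auto intro!: derivative_eq_intros)
    then have 1: "((\<lambda>r. complex_of_real (r powr b)) has_vector_derivative of_real (b * x powr (b - 1))) (at x)"
      by (intro has_vector_derivative_of_real) (simp add: has_real_derivative_iff_has_vector_derivative)
    have "((\<lambda>z. exp (- s * z)) has_field_derivative (- s * exp (- s * of_real x))) (at (of_real x))"
      by (auto intro!: derivative_eq_intros)
    then have 2: "((\<lambda>r. exp (- s * of_real r)) has_vector_derivative (- s * exp (- s * of_real x))) (at x)"
      by (rule has_vector_derivative_real_field)
    from has_vector_derivative_mult[OF 1 2]
    show "(?F has_vector_derivative ?f x) (at x)" by (simp add: algebra_simps)
    show "isCont ?f x" using x by (intro continuous_intros) auto
  next
    show "set_integrable lborel (einterval 0 \<infinity>) ?f"
      using Bochner_Integration.integrable_diff[OF int]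
      unfolding set_integrable_def einterval_eq zero_ereal_def eq .
    have n: "norm (?F r) = r powr b * exp (- Re s * r)" for r by (simp add: norm_mult)
    have "((\<lambda>r. r powr b * exp (- Re s * r)) \<longlongrightarrow> 0) at_top"
      using assms by real_asymp
    then have "(?F \<longlongrightarrow> 0) at_top"
      by (subst tendsto_norm_zero_iff[symmetric], subst n)
    then show "((?F \<circ> real_of_ereal) \<longlongrightarrow> 0) (at_left \<infinity>)"
      by (simp only: ereal_tendsto_simps)
    have "((\<lambda>r. r powr b * exp (- Re s * r)) \<longlongrightarrow> 0) (at_right 0)"
      using assms by real_asymp
    then have "(?F \<longlongrightarrow> 0) (at_right 0)"
      by (subst tendsto_norm_zero_iff[symmetric], subst n)
    then show "((?F \<circ> real_of_ereal) \<longlongrightarrow> 0) (at_right 0)"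
      unfolding zero_ereal_def by (simp only: ereal_tendsto_simps)
  qed simp
  then have "(LINT r|lborel. of_real b * gamma_kernel b s r - s * gamma_kernel (b + 1) s r) = 0"
    unfolding zero_ereal_def interval_integral_to_infinity_eq set_lebesgue_integral_def eq by simp
  then show ?thesis using Bochner_Integration.integral_diff[OF int] by simp
qed

text \<open>On the line \<open>s = c + iy\<close> the integral \<open>K\<close> solves the linear
  equation \<open>K' = - (i b / s) K\<close>, as does \<open>s^(-b)\<close>. Hence
  \<open>K s^b\<close> is constant, and the real Gamma integral at \<open>y = 0\<close> gives the
  constant.\<close>

lemma integral_gamma_kernel_aux:
  fixes b c y :: real
  assumes "b > 0" "c > 0"
  shows "(LINT r|lborel. gamma_kernel b (of_real c + \<i> * of_real y) r)
       = of_real (Gamma b) * (of_real c + \<i> * of_real y) powr (- of_real b)"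
proof -
  define s where "s = (\<lambda>y. complex_of_real c + \<i> * of_real y)"
  define K where "K = (\<lambda>y. LINT r|lborel. gamma_kernel b (s y) r)"
  have Res [simp]: "Re (s y) = c" for y by (simp add: s_def)
  have s: "s y \<notin> \<real>\<^sub>\<le>\<^sub>0" "s y \<noteq> 0" for y
    using Res[of y] assms(2) by (auto simp: complex_nonpos_Reals_iff simp del: Res)
  have K': "(K has_vector_derivative (- \<i> * b / s y * K y)) (at y)" for y
  proof -
    \<comment> \<open>Differentiation brings down \<open>- i r\<close>, which raises
      \<open>b\<close> by one; integration by parts lowers it again.\<close>
    have "(K has_vector_derivative (LINT r|lborel. - \<i> * gamma_kernel (b + 1) (s y) r)) (at y)"
      unfolding K_def
    proof (rule has_vector_derivative_lebesgue_integral)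
      show "integrable lborel (gamma_kernel b (s t))" for t
        using assms by (intro integrable_gamma_kernel) auto
      show "integrable lborel (\<lambda>r. norm (gamma_kernel (b + 1) (of_real c) r))"
        using assms by (intro integrable_norm integrable_gamma_kernel) auto
      show "norm (- \<i> * gamma_kernel (b + 1) (s t) r) \<le> norm (gamma_kernel (b + 1) (of_real c) r)" for t r
        by (simp add: norm_mult norm_gamma_kernel)
      show "((\<lambda>t. gamma_kernel b (s t) r) has_vector_derivative - \<i> * gamma_kernel (b + 1) (s t) r) (at t)" for t r
      proof (cases "r > 0")
        case True
        have "((\<lambda>z. of_real (r powr (b - 1)) * exp (- (of_real c + \<i> * z) * of_real r)) has_field_derivative
           (of_real (r powr (b - 1)) * (exp (- (of_real c + \<i> * of_real t) * of_real r) * (- \<i> * of_real r)))) (at (of_real t))"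
          by (auto intro!: derivative_eq_intros)
        from has_vector_derivative_real_field[OF this] True show ?thesis
          by (simp add: gamma_kernel_def s_def mult_ac powr_diff)
      next
        case False
        then show ?thesis by (simp add: gamma_kernel_def)
      qed
    qed
    moreover have "(LINT r|lborel. - \<i> * gamma_kernel (b + 1) (s y) r) = - \<i> * b / s y * K y"
      using gamma_kernel_by_parts[of b "s y"] assms s(2)[of y]
      by (simp add: K_def field_simps)
    ultimately show ?thesis by simp
  qed
  have P': "((\<lambda>y. s y powr of_real b) has_vector_derivative (\<i> * b / s y * s y powr of_real b)) (at y)" for y
  proof -
    have "((\<lambda>z. (of_real c + \<i> * z) powr of_real b) has_field_derivative
        (\<i> * b / s y * s y powr of_real b)) (at (of_real y))"
      using s[of y] by (auto intro!: derivative_eq_intros simp: s_def powr_diff)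
    from has_vector_derivative_real_field[OF this] show ?thesis by (simp add: s_def)
  qed
  have "((\<lambda>y. K y * s y powr of_real b) has_vector_derivative 0) (at y)" for y
    using has_vector_derivative_mult[OF K' P', of y] by (simp add: algebra_simps)
  then obtain C where "\<And>y. y \<in> UNIV \<Longrightarrow> K y * s y powr of_real b = C"
    by (rule has_vector_derivative_zero_constant[OF convex_UNIV has_vector_derivative_at_within]) blast
  then have "K y * s y powr of_real b = K 0 * s 0 powr of_real b"
    by simp
  moreover have "K 0 = of_real (Gamma b * c powr (- b))"
  proof -
    have "gamma_kernel b (s 0) = (\<lambda>r. of_real (indicator {0<..} r * (r powr (b - 1) * exp (- c * r))))"
      by (rule ext) (simp add: gamma_kernel_def s_def exp_of_real indicator_def flip: of_real_mult of_real_minus)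
    then have "K 0 = of_real (LINT r|lborel. indicator {0<..} r * (r powr (b - 1) * exp (- c * r)))"
      by (simp only: K_def integral_complex_of_real)
    then show ?thesis
      using has_bochner_integral_integral_eq[OF has_bochner_integral_Gamma_scaled[OF assms]] by simp
  qed
  moreover have "s 0 powr of_real b = of_real (c powr b)"
    using assms by (simp add: s_def powr_of_real)
  ultimately have "K y * s y powr of_real b = of_real (Gamma b)"
    using assms by (simp add: powr_minus flip: of_real_mult)
  then have "K y = of_real (Gamma b) * s y powr (- of_real b)"
    using s(2)[of y] by (simp add: powr_minus field_simps)
  then show ?thesis by (simp add: K_def s_def)
qed

theorem integral_gamma_kernel:
  assumes "b > 0" "Re s > 0"
  shows "(LINT r|lborel. gamma_kernel b s r) = of_real (Gamma b) * s powr (- of_real b)"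
  using integral_gamma_kernel_aux[OF assms, of "Im s"] by (simp flip: complex_eq)

section \<open>Symbols of the two operators\<close>

lemma frac_classD:
  assumes "u \<in> frac_class n \<alpha>"
  shows "continuous_on UNIV u" "integrable lborel u"
    "integrable lborel (\<lambda>\<omega>. (1 + \<bar>\<omega>\<bar>) powr (real n + \<alpha>) * norm (fourier u \<omega>))"
  using assms by (simp_all add: frac_class_def)

lemma fourier_measurable_frac_class:
  "u \<in> frac_class n \<alpha> \<Longrightarrow> fourier u \<in> borel_measurable borel"
  by (intro borel_measurable_fourier frac_classD)

text \<open>A majorant for power singularities at the origin, assembled from the Gamma integrand and
  its reflection.\<close>

lemma integrable_abs_powr_exp:
  fixes p :: real
  assumes "p > -1"
  shows "integrable lborel (\<lambda>x::real. \<bar>x\<bar> powr p * exp (- \<bar>x\<bar>))"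
proof -
  let ?g = "\<lambda>r. indicator {0<..} r * (r powr p * exp (- r))"
  have g: "integrable lborel ?g"
    using has_bochner_integral_Gamma_scaled[of "p + 1" 1] assms by (auto dest: integrable.intros)
  then have "integrable lborel (\<lambda>x. ?g x + ?g (0 + (- 1) * x))"
    by (intro Bochner_Integration.integrable_add lborel_integrable_real_affine) auto
  moreover have "?g x + ?g (0 + (- 1) * x) = \<bar>x\<bar> powr p * exp (- \<bar>x\<bar>)" for x
    by (cases "x = 0") (auto simp: indicator_def)
  ultimately show ?thesis by simp
qed

text \<open>For \<open>|\<omega>| \<le> 1\<close> the transform is bounded by the L1 norm of
  \<open>u\<close>, so \<open>p > -1\<close> suffices; beyond that the weight of the class takes
  over. Negative \<open>p\<close> is included for the symbol of order
  \<open>\<alpha> - 1\<close>.\<close>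

lemma integrable_powr_fourier:
  assumes u: "u \<in> frac_class n \<alpha>" and p: "p > -1" "p \<le> real n + \<alpha>" "\<alpha> > 0"
  shows "integrable lborel (\<lambda>\<omega>. \<bar>\<omega>\<bar> powr p * norm (fourier u \<omega>))"
proof -
  note [measurable] = fourier_measurable_frac_class[OF u]
  define M where "M = (LINT t|lborel. norm (u t))"
  have M: "norm (fourier u \<omega>) \<le> M" for \<omega> unfolding M_def by (rule norm_fourier_le)
  have "integrable lborel (\<lambda>\<omega>. M * exp 1 * (\<bar>\<omega>\<bar> powr p * exp (- \<bar>\<omega>\<bar>))
      + (1 + \<bar>\<omega>\<bar>) powr (real n + \<alpha>) * norm (fourier u \<omega>))"
    by (intro Bochner_Integration.integrable_add integrable_mult_right integrable_abs_powr_exp p frac_classD[OF u])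
  then show ?thesis
  proof (rule Bochner_Integration.integrable_bound)
    show "AE \<omega> in lborel. norm (\<bar>\<omega>\<bar> powr p * norm (fourier u \<omega>))
        \<le> norm (M * exp 1 * (\<bar>\<omega>\<bar> powr p * exp (- \<bar>\<omega>\<bar>)) + (1 + \<bar>\<omega>\<bar>) powr (real n + \<alpha>) * norm (fourier u \<omega>))"
    proof (rule AE_I2)
      fix \<omega> :: real
      have nn: "0 \<le> M * exp 1 * (\<bar>\<omega>\<bar> powr p * exp (- \<bar>\<omega>\<bar>))" "0 \<le> (1 + \<bar>\<omega>\<bar>) powr (real n + \<alpha>) * norm (fourier u \<omega>)"
        using order_trans[OF norm_ge_zero M] by auto
      have "\<bar>\<omega>\<bar> powr p * norm (fourier u \<omega>)
        \<le> M * exp 1 * (\<bar>\<omega>\<bar> powr p * exp (- \<bar>\<omega>\<bar>)) + (1 + \<bar>\<omega>\<bar>) powr (real n + \<alpha>) * norm (fourier u \<omega>)"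
      proof (cases "\<bar>\<omega>\<bar> \<le> 1")
        case True
        have "\<bar>\<omega>\<bar> powr p * norm (fourier u \<omega>) \<le> \<bar>\<omega>\<bar> powr p * M" by (intro mult_left_mono M) simp
        also have "\<dots> * 1 \<le> \<bar>\<omega>\<bar> powr p * M * exp (1 - \<bar>\<omega>\<bar>)"
          using True order_trans[OF norm_ge_zero M] by (intro mult_left_mono) auto
        also have "\<dots> = M * exp 1 * (\<bar>\<omega>\<bar> powr p * exp (- \<bar>\<omega>\<bar>))"
          by (simp add: exp_diff exp_minus field_simps)
        finally show ?thesis using nn by linarith
      next
        case False
        then have "\<bar>\<omega>\<bar> powr p \<le> \<bar>\<omega>\<bar> powr (real n + \<alpha>)" using p by (intro powr_mono) auto
        also have "\<dots> \<le> (1 + \<bar>\<omega>\<bar>) powr (real n + \<alpha>)"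
        proof (rule powr_mono2)
          show "real n + \<alpha> \<ge> 0" using p by simp
        qed auto
        finally have "\<bar>\<omega>\<bar> powr p * norm (fourier u \<omega>) \<le> (1 + \<bar>\<omega>\<bar>) powr (real n + \<alpha>) * norm (fourier u \<omega>)"
          by (intro mult_right_mono) auto
        then show ?thesis using nn by linarith
      qed
      then show "norm (\<bar>\<omega>\<bar> powr p * norm (fourier u \<omega>))
        \<le> norm (M * exp 1 * (\<bar>\<omega>\<bar> powr p * exp (- \<bar>\<omega>\<bar>)) + (1 + \<bar>\<omega>\<bar>) powr (real n + \<alpha>) * norm (fourier u \<omega>))"
        using nn by simp
    qed
  qed measurable
qed


lemma frac_class_inversion:
  assumes u: "u \<in> frac_class n \<alpha>" and "\<alpha> > 0"
  shows "integrable lborel (fourier u)"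
    and "u t = 1 / (2 * pi) * (LINT \<omega>|lborel. exp (- \<i> * of_real (\<omega> * t)) * fourier u \<omega>)"
proof -
  \<comment> \<open>\<open>0 powr 0\<close> is 0, so the weight equals 1 only off the null set
    \<open>{0}\<close>.\<close>
  have "AE \<omega> in lborel. \<bar>\<omega>\<bar> powr 0 * norm (fourier u \<omega>) = norm (fourier u \<omega>)"
    by (rule AE_mp[OF AE_lborel_singleton[of 0]]) (auto intro!: AE_I2)
  moreover have "integrable lborel (\<lambda>\<omega>. \<bar>\<omega>\<bar> powr 0 * norm (fourier u \<omega>))"
    using assms by (intro integrable_powr_fourier[OF u]) auto
  ultimately have "integrable lborel (\<lambda>\<omega>. norm (fourier u \<omega>))"
    by (subst integrable_cong_AE[where g = "\<lambda>\<omega>. \<bar>\<omega>\<bar> powr 0 * norm (fourier u \<omega>)"])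
       (use fourier_measurable_frac_class[OF u] in auto)
  then show *: "integrable lborel (fourier u)"
    using fourier_measurable_frac_class[OF u] by (subst (asm) integrable_norm_iff) auto
  show "u t = 1 / (2 * pi) * (LINT \<omega>|lborel. exp (- \<i> * of_real (\<omega> * t)) * fourier u \<omega>)"
    by (intro fourier_inversion frac_classD[OF u] *)
qed

lemma frac_class_bounded:
  assumes u: "u \<in> frac_class n \<alpha>" and "\<alpha> > 0"
  obtains M where "M \<ge> 0" "\<And>t. norm (u t) \<le> M"
proof
  let ?M = "1 / (2 * pi) * (LINT \<omega>|lborel. norm (fourier u \<omega>))"
  show "?M \<ge> 0" by simp
  show "norm (u t) \<le> ?M" for t
  proof -
    have "norm (LINT \<omega>|lborel. exp (- \<i> * of_real (\<omega> * t)) * fourier u \<omega>)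
        \<le> (LINT \<omega>|lborel. norm (exp (- \<i> * of_real (\<omega> * t)) * fourier u \<omega>))"
      by (rule integral_norm_bound)
    also have "\<dots> = (LINT \<omega>|lborel. norm (fourier u \<omega>))" by (simp add: norm_mult)
    finally show ?thesis
      by (subst frac_class_inversion(2)[OF assms]) (simp add: norm_mult norm_divide divide_right_mono)
  qed
qed

text \<open>Near \<open>r = 0\<close> boundedness of \<open>u\<close> and
  \<open>\<alpha> < 1\<close> give integrability; for \<open>r > 1\<close> the kernel is at most 1
  and \<open>u\<close> itself is integrable.\<close>

lemma integrable_singular_convolution:
  fixes u :: "real \<Rightarrow> complex"
  assumes \<alpha>: "0 < \<alpha>" "\<alpha> < 1" and u: "u \<in> frac_class n \<alpha>"
  shows "integrable lborel (\<lambda>r. of_real (indicator {0<..} r * r powr (- \<alpha>)) * u (t - r))"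
proof -
  note [measurable] = borel_measurable_continuous_onI[OF frac_classD(1)[OF u]]
  obtain M where M: "M \<ge> 0" "\<And>t. norm (u t) \<le> M"
    using frac_class_bounded[OF u \<alpha>(1)] by blast
  have "integrable lborel (\<lambda>r. u (t + (- 1) * r))"
    using frac_classD(2)[OF u] by (rule lborel_integrable_real_affine) simp
  then have "integrable lborel (\<lambda>r. M * exp 1 * (\<bar>r\<bar> powr (- \<alpha>) * exp (- \<bar>r\<bar>)) + norm (u (t - r)))"
    using \<alpha> by (intro Bochner_Integration.integrable_add integrable_mult_right
        integrable_abs_powr_exp integrable_norm) auto
  then show ?thesis
  proof (rule Bochner_Integration.integrable_bound)
    show "AE r in lborel. norm (of_real (indicator {0<..} r * r powr (- \<alpha>)) * u (t - r))
        \<le> norm (M * exp 1 * (\<bar>r\<bar> powr (- \<alpha>) * exp (- \<bar>r\<bar>)) + norm (u (t - r)))"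
    proof (rule AE_I2)
      fix r :: real
      have nn: "0 \<le> M * exp 1 * (\<bar>r\<bar> powr (- \<alpha>) * exp (- \<bar>r\<bar>))" using M by auto
      have "norm (of_real (indicator {0<..} r * r powr (- \<alpha>)) * u (t - r))
        \<le> M * exp 1 * (\<bar>r\<bar> powr (- \<alpha>) * exp (- \<bar>r\<bar>)) + norm (u (t - r))"
      proof -
        consider "r \<le> 0" | "0 < r" "r \<le> 1" | "1 < r" by linarith
        then show ?thesis
        proof cases
          case 1
          then show ?thesis using nn by simp
        next
          case 2
          have "norm (of_real (indicator {0<..} r * r powr (- \<alpha>)) * u (t - r)) = r powr (- \<alpha>) * norm (u (t - r))"
            using 2 by (simp add: norm_mult)
          also have "\<dots> \<le> r powr (- \<alpha>) * M" by (intro mult_left_mono M) simp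
          also have "\<dots> * 1 \<le> r powr (- \<alpha>) * M * exp (1 - r)"
            using 2 M by (intro mult_left_mono) auto
          also have "\<dots> = M * exp 1 * (\<bar>r\<bar> powr (- \<alpha>) * exp (- \<bar>r\<bar>))"
            using 2 by (simp add: exp_diff exp_minus field_simps)
          finally show ?thesis using norm_ge_zero[of "u (t - r)"] by linarith
        next
          case 3
          have "norm (of_real (indicator {0<..} r * r powr (- \<alpha>)) * u (t - r)) = r powr (- \<alpha>) * norm (u (t - r))"
            using 3 by (simp add: norm_mult)
          also have "\<dots> \<le> 1 * norm (u (t - r))"
            using 3 \<alpha> powr_mono[of "- \<alpha>" 0 r] by (intro mult_right_mono) auto
          finally show ?thesis using nn by linarith
        qed
      qed
      then show "norm (of_real (indicator {0<..} r * r powr (- \<alpha>)) * u (t - r))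
        \<le> norm (M * exp 1 * (\<bar>r\<bar> powr (- \<alpha>) * exp (- \<bar>r\<bar>)) + norm (u (t - r)))"
        using nn by simp
    qed
  qed measurable
qed

section \<open>The Riemann-Liouville derivative as a Fourier multiplier\<close>

lemma RL_integrand_shift:
  "indicator {..<t} (t - r) *\<^sub>R RL_kernel \<alpha> u t (t - r)
     = of_real (indicator {0<..} r * r powr (- \<alpha>)) * u (t - r)"
  by (auto simp: RL_kernel_def indicator_def powr_minus field_simps)

lemma RL_kernel_integrable:
  assumes "0 < \<alpha>" "\<alpha> < 1" "u \<in> frac_class n \<alpha>"
  shows "set_integrable lborel {..<t} (RL_kernel \<alpha> u t)"
proof -
  have "integrable lborel (\<lambda>r. indicator {..<t} (t + (- 1) * r) *\<^sub>R RL_kernel \<alpha> u t (t + (- 1) * r))"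
    using integrable_singular_convolution[OF assms, of t] by (simp add: RL_integrand_shift)
  then show ?thesis
    unfolding set_integrable_def by (subst (asm) lborel_integrable_real_affine_iff) auto
qed

lemma RL_primitive_shift:
  "RL_primitive \<alpha> u t = (LINT r|lborel. of_real (indicator {0<..} r * r powr (- \<alpha>)) * u (t - r))"
  unfolding RL_primitive_def set_lebesgue_integral_def
  by (subst lborel_integral_real_affine[where c = "-1" and t = t]) (auto simp: RL_integrand_shift)

text \<open>Inserting the inversion formula for \<open>u (t - r)\<close> and exchanging the
  integrals leaves the Laplace transform of \<open>r^(-\<alpha>)\<close> at
  \<open>s = e - i\<omega>\<close>, hence the power \<open>\<alpha> - 1\<close> and the Gamma
  factor.\<close>

lemma damped_convolution:
  fixes u :: "real \<Rightarrow> complex"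
  assumes \<alpha>: "0 < \<alpha>" "\<alpha> < 1" and u: "u \<in> frac_class n \<alpha>" and e: "e > 0"
  shows "(LINT r|lborel. gamma_kernel (1 - \<alpha>) (of_real e) r * u (t - r))
    = of_real (Gamma (1 - \<alpha>) / (2 * pi)) *
      (LINT \<omega>|lborel. fourier u \<omega> * (exp (- \<i> * of_real (\<omega> * t)) *
         (of_real e - \<i> * of_real \<omega>) powr of_real (\<alpha> - 1)))"
proof -
  let ?g = "gamma_kernel (1 - \<alpha>) (of_real e)"
  have g: "integrable lborel ?g" using \<alpha> e by (intro integrable_gamma_kernel) auto
  have inner: "(LINT r|lborel. exp (- \<i> * of_real (\<omega> * (t - r))) * ?g r)
      = exp (- \<i> * of_real (\<omega> * t)) * (of_real (Gamma (1 - \<alpha>)) * (of_real e - \<i> * of_real \<omega>) powr of_real (\<alpha> - 1))" for \<omega>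
  proof -
    have "exp (- \<i> * of_real (\<omega> * (t - r))) * ?g r
        = exp (- \<i> * of_real (\<omega> * t)) * gamma_kernel (1 - \<alpha>) (of_real e - \<i> * of_real \<omega>) r" for r
      by (simp add: gamma_kernel_def algebra_simps flip: exp_add)
    then show ?thesis
      using \<alpha> e by (simp only: integral_mult_right_zero) (subst integral_gamma_kernel, auto)
  qed
  have "(LINT r|lborel. ?g r * u (t - r))
      = (LINT r|lborel. of_real (1 / (2 * pi)) * (?g r * (LINT \<omega>|lborel. exp (- \<i> * of_real (\<omega> * (t - r))) * fourier u \<omega>)))"
    by (subst frac_class_inversion(2)[OF u \<alpha>(1)]) (simp add: mult_ac)
  also have "\<dots> = of_real (1 / (2 * pi)) * (LINT \<omega>|lborel. fourier u \<omega> * (LINT r|lborel. exp (- \<i> * of_real (\<omega> * (t - r))) * ?g r))"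
    unfolding integral_mult_right_zero
    by (subst fubini_multiplier[OF g frac_class_inversion(1)[OF u \<alpha>(1)]]) simp_all
  also have "(LINT \<omega>|lborel. fourier u \<omega> * (LINT r|lborel. exp (- \<i> * of_real (\<omega> * (t - r))) * ?g r))
     = (LINT \<omega>|lborel. fourier u \<omega> * (exp (- \<i> * of_real (\<omega> * t)) * (of_real (Gamma (1 - \<alpha>)) * (of_real e - \<i> * of_real \<omega>) powr of_real (\<alpha> - 1))))"
    unfolding inner ..
  also have "(LINT \<omega>|lborel. fourier u \<omega> * (exp (- \<i> * of_real (\<omega> * t)) * (of_real (Gamma (1 - \<alpha>)) * (of_real e - \<i> * of_real \<omega>) powr of_real (\<alpha> - 1))))
     = of_real (Gamma (1 - \<alpha>)) * (LINT \<omega>|lborel. fourier u \<omega> * (exp (- \<i> * of_real (\<omega> * t)) * (of_real e - \<i> * of_real \<omega>) powr of_real (\<alpha> - 1)))"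
    unfolding integral_mult_right_zero[symmetric] by (simp only: mult_ac)
  finally show ?thesis by (simp add: mult_ac)
qed

text \<open>The Fourier integral of the kernel \<open>r\<^sup>-\<^sup>\<alpha>\<close> converges only conditionally; damping the kernel by
  \<open>e\<^sup>-\<^sup>\<epsilon>\<^sup>r\<close> makes Fubini's theorem applicable.\<close>

lemma RL_primitive_fourier:
  fixes u :: "real \<Rightarrow> complex"
  assumes \<alpha>: "0 < \<alpha>" "\<alpha> < 1" and u: "u \<in> frac_class n \<alpha>"
  shows "RL_primitive \<alpha> u t = of_real (Gamma (1 - \<alpha>) / (2 * pi)) *
      (LINT \<omega>|lborel. fourier u \<omega> * (exp (- \<i> * of_real (\<omega> * t)) *
         (- \<i> * of_real \<omega>) powr of_real (\<alpha> - 1)))"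
proof -
  note [measurable] = borel_measurable_continuous_onI[OF frac_classD(1)[OF u]]
    fourier_measurable_frac_class[OF u]
  let ?e = "\<lambda>k. inverse (real (Suc k))"
  let ?k = "\<lambda>r. of_real (indicator {0<..} r * r powr (- \<alpha>)) * u (t - r)"
  have gk: "gamma_kernel (1 - \<alpha>) (of_real e) r * u (t - r) = of_real (exp (- e * r)) * ?k r" for e r
    by (simp add: gamma_kernel_def exp_of_real indicator_def flip: of_real_mult of_real_minus)
  have "(\<lambda>k. LINT r|lborel. of_real (exp (- ?e k * r)) * ?k r) \<longlonglongrightarrow> (LINT r|lborel. ?k r)"
  proof (rule integral_dominated_convergence[where w = "\<lambda>r. norm (?k r)"])
    show "integrable lborel (\<lambda>r. norm (?k r))"
      by (intro integrable_norm integrable_singular_convolution[OF \<alpha> u])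
    show "AE r in lborel. (\<lambda>k. of_real (exp (- ?e k * r)) * ?k r) \<longlonglongrightarrow> ?k r"
    proof (rule AE_I2)
      fix r :: real
      have "(\<lambda>k. of_real (exp (- ?e k * r)) * ?k r) \<longlonglongrightarrow> of_real (exp (- 0 * r)) * ?k r"
        by (intro tendsto_intros LIMSEQ_inverse_real_of_nat)
      then show "(\<lambda>k. of_real (exp (- ?e k * r)) * ?k r) \<longlonglongrightarrow> ?k r" by simp
    qed
    show "AE r in lborel. norm (of_real (exp (- ?e k * r)) * ?k r) \<le> norm (?k r)" for k
      by (rule AE_I2) (auto simp: norm_mult indicator_def intro!: mult_left_le_one_le)
  qed measurable
  then have lim1: "(\<lambda>k. LINT r|lborel. gamma_kernel (1 - \<alpha>) (of_real (?e k)) r * u (t - r)) \<longlonglongrightarrow> RL_primitive \<alpha> u t"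
    unfolding gk RL_primitive_shift .
  \<comment> \<open>As \<open>|e - i\<omega>| \<ge> |\<omega>|\<close> and
    \<open>\<alpha> - 1\<close> is negative, the undamped symbol dominates all damped ones.
    Convergence and bound may fail at \<open>\<omega> = 0\<close>, which is a null set.\<close>
  have "(\<lambda>k. LINT \<omega>|lborel. fourier u \<omega> * (exp (- \<i> * of_real (\<omega> * t)) * (of_real (?e k) - \<i> * of_real \<omega>) powr of_real (\<alpha> - 1)))
     \<longlonglongrightarrow> (LINT \<omega>|lborel. fourier u \<omega> * (exp (- \<i> * of_real (\<omega> * t)) * (- \<i> * of_real \<omega>) powr of_real (\<alpha> - 1)))"
  proof (rule integral_dominated_convergence[where w = "\<lambda>\<omega>. \<bar>\<omega>\<bar> powr (\<alpha> - 1) * norm (fourier u \<omega>)"])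
    show "integrable lborel (\<lambda>\<omega>. \<bar>\<omega>\<bar> powr (\<alpha> - 1) * norm (fourier u \<omega>))"
      using \<alpha> by (intro integrable_powr_fourier[OF u]) auto
    show "AE \<omega> in lborel. (\<lambda>k. fourier u \<omega> * (exp (- \<i> * of_real (\<omega> * t)) * (of_real (?e k) - \<i> * of_real \<omega>) powr of_real (\<alpha> - 1)))
       \<longlonglongrightarrow> fourier u \<omega> * (exp (- \<i> * of_real (\<omega> * t)) * (- \<i> * of_real \<omega>) powr of_real (\<alpha> - 1))"
      using AE_lborel_singleton[of 0]
    proof eventually_elim
      case (elim \<omega>)
      have "(\<lambda>k. complex_of_real (?e k) - \<i> * of_real \<omega>) \<longlonglongrightarrow> of_real 0 - \<i> * of_real \<omega>"
        by (intro tendsto_intros LIMSEQ_inverse_real_of_nat)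
      then have "(\<lambda>k. (of_real (?e k) - \<i> * of_real \<omega>) powr of_real (\<alpha> - 1)) \<longlonglongrightarrow> (- \<i> * of_real \<omega>) powr of_real (\<alpha> - 1)"
        using elim by (intro tendsto_powr_complex tendsto_const) (auto simp: complex_nonpos_Reals_iff)
      then show ?case by (intro tendsto_mult tendsto_const)
    qed
    show "AE \<omega> in lborel. norm (fourier u \<omega> * (exp (- \<i> * of_real (\<omega> * t)) * (of_real (?e k) - \<i> * of_real \<omega>) powr of_real (\<alpha> - 1)))
       \<le> \<bar>\<omega>\<bar> powr (\<alpha> - 1) * norm (fourier u \<omega>)" for k
      using AE_lborel_singleton[of 0]
    proof eventually_elim
      case (elim \<omega>)
      have "\<bar>\<omega>\<bar> \<le> norm (of_real (?e k) - \<i> * of_real \<omega>)"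
        using abs_Im_le_cmod[of "of_real (?e k) - \<i> * of_real \<omega>"] by simp
      then have "norm (of_real (?e k) - \<i> * of_real \<omega>) powr (\<alpha> - 1) \<le> \<bar>\<omega>\<bar> powr (\<alpha> - 1)"
        using elim \<alpha> by (intro powr_mono2') auto
      from mult_left_mono[OF this, of "norm (fourier u \<omega>)"] show ?case
        by (simp add: norm_mult norm_powr_real_powr' mult.commute del: of_nat_Suc)
    qed
  qed measurable
  then have "(\<lambda>k. LINT r|lborel. gamma_kernel (1 - \<alpha>) (of_real (?e k)) r * u (t - r))
     \<longlonglongrightarrow> of_real (Gamma (1 - \<alpha>) / (2 * pi)) *
      (LINT \<omega>|lborel. fourier u \<omega> * (exp (- \<i> * of_real (\<omega> * t)) * (- \<i> * of_real \<omega>) powr of_real (\<alpha> - 1)))"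
    unfolding damped_convolution[OF \<alpha> u inverse_positive_iff_positive[THEN iffD2, OF of_nat_0_less_iff[THEN iffD2, OF zero_less_Suc]]]
    by (rule tendsto_mult[OF tendsto_const])
  with lim1 show ?thesis by (rule LIMSEQ_unique)
qed

text \<open>Differentiation under the integral brings down \<open>-i\<omega>\<close>, raising the
  power from \<open>\<alpha> - 1\<close> to \<open>\<alpha>\<close>; the exponential has modulus 1,
  so the majorant is independent of \<open>t\<close>.\<close>

proposition RL_primitive_derivative:
  fixes u :: "real \<Rightarrow> complex"
  assumes \<alpha>: "0 < \<alpha>" "\<alpha> < 1" and u: "u \<in> frac_class n \<alpha>"
  shows "(RL_primitive \<alpha> u has_vector_derivative of_real (Gamma (1 - \<alpha>) / (2 * pi)) *
      (LINT \<omega>|lborel. fourier u \<omega> * (exp (- \<i> * of_real (\<omega> * t)) * (- \<i> * of_real \<omega>) powr of_real \<alpha>))) (at t)"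
proof -
  note [measurable] = fourier_measurable_frac_class[OF u]
  have "((\<lambda>t. LINT \<omega>|lborel. fourier u \<omega> * (exp (- \<i> * of_real (\<omega> * t)) * (- \<i> * of_real \<omega>) powr of_real (\<alpha> - 1)))
      has_vector_derivative
      (LINT \<omega>|lborel. fourier u \<omega> * (exp (- \<i> * of_real (\<omega> * t)) * (- \<i> * of_real \<omega>) powr of_real \<alpha>))) (at t)"
  proof (rule has_vector_derivative_lebesgue_integral)
    show "integrable lborel (\<lambda>\<omega>. \<bar>\<omega>\<bar> powr \<alpha> * norm (fourier u \<omega>))"
      using \<alpha> by (intro integrable_powr_fourier[OF u]) auto
    show "norm (fourier u \<omega> * (exp (- \<i> * of_real (\<omega> * t)) * (- \<i> * of_real \<omega>) powr of_real \<alpha>))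
        \<le> \<bar>\<omega>\<bar> powr \<alpha> * norm (fourier u \<omega>)" for t \<omega>
      by (simp add: norm_mult norm_powr_real_powr')
    show "integrable lborel (\<lambda>\<omega>. fourier u \<omega> * (exp (- \<i> * of_real (\<omega> * t)) * (- \<i> * of_real \<omega>) powr of_real (\<alpha> - 1)))" for t
    proof (rule Bochner_Integration.integrable_bound)
      show "integrable lborel (\<lambda>\<omega>. \<bar>\<omega>\<bar> powr (\<alpha> - 1) * norm (fourier u \<omega>))"
        using \<alpha> by (intro integrable_powr_fourier[OF u]) auto
      show "AE \<omega> in lborel. norm (fourier u \<omega> * (exp (- \<i> * of_real (\<omega> * t)) * (- \<i> * of_real \<omega>) powr of_real (\<alpha> - 1)))
          \<le> norm (\<bar>\<omega>\<bar> powr (\<alpha> - 1) * norm (fourier u \<omega>))"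
        by (rule AE_I2) (simp add: norm_mult norm_powr_real_powr' del: of_real_diff)
    qed measurable
    show "((\<lambda>t. fourier u \<omega> * (exp (- \<i> * of_real (\<omega> * t)) * (- \<i> * of_real \<omega>) powr of_real (\<alpha> - 1)))
        has_vector_derivative
        fourier u \<omega> * (exp (- \<i> * of_real (\<omega> * t)) * (- \<i> * of_real \<omega>) powr of_real \<alpha>)) (at t)" for t \<omega>
    proof -
      \<comment> \<open>Valid at \<open>\<omega> = 0\<close> as well, where both sides are
        0.\<close>
      have p: "(- \<i> * of_real \<omega>) powr of_real \<alpha> = - \<i> * of_real \<omega> * (- \<i> * of_real \<omega>) powr of_real (\<alpha> - 1)"
        using powr_diff[of "- \<i> * of_real \<omega>" "of_real \<alpha>" 1] by (cases "\<omega> = 0") auto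
      have "((\<lambda>z. fourier u \<omega> * (exp (- \<i> * (of_real \<omega> * z)) * (- \<i> * of_real \<omega>) powr of_real (\<alpha> - 1)))
          has_field_derivative
          fourier u \<omega> * (exp (- \<i> * (of_real \<omega> * of_real t)) * (- \<i> * of_real \<omega>) * (- \<i> * of_real \<omega>) powr of_real (\<alpha> - 1))) (at (of_real t))"
        by (rule derivative_eq_intros refl | simp)+
      from has_vector_derivative_real_field[OF this] show ?thesis
        unfolding p by (simp add: mult.assoc)
    qed
  qed
  from has_vector_derivative_mult_right[OF this, of "of_real (Gamma (1 - \<alpha>) / (2 * pi))"]
  show ?thesis unfolding RL_primitive_fourier[OF \<alpha> u, abs_def] .
qed

corollary RL_deriv_fourier:
  assumes \<alpha>: "0 < \<alpha>" "\<alpha> < 1" and u: "u \<in> frac_class n \<alpha>"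
  shows "RL_deriv \<alpha> u t = of_real (1 / (2 * pi)) *
      (LINT \<omega>|lborel. fourier u \<omega> * (exp (- \<i> * of_real (\<omega> * t)) * (- \<i> * of_real \<omega>) powr of_real \<alpha>))"
proof -
  have "Gamma (1 - \<alpha>) > 0" using \<alpha> by (intro Gamma_real_pos) auto
  then show ?thesis
    unfolding RL_deriv_def vector_derivative_at[OF RL_primitive_derivative[OF \<alpha> u]] by simp
qed

lemma has_RL_deriv_at_frac_class:
  assumes "0 < \<alpha>" "\<alpha> < 1" "u \<in> frac_class n \<alpha>"
  shows "has_RL_deriv_at \<alpha> u t"
  unfolding has_RL_deriv_at_def
  using RL_kernel_integrable[OF assms] RL_primitive_derivative[OF assms, of t]
  by (auto intro: differentiableI_vector)

text \<open>A shift by \<open>l * \<tau>\<close> multiplies the transform by the \<open>l\<close>-th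
  power of \<open>e^(i\<omega>\<tau>)\<close>, so the sum is the power series at a boundary point.
  Absolute summability of the weights justifies exchanging sum and integral.\<close>

lemma diff_op_fourier:
  fixes u :: "real \<Rightarrow> complex"
  assumes \<alpha>: "0 < \<alpha>" "\<alpha> < 1" and u: "u \<in> frac_class n \<alpha>"
    and branch: "positive_power_branch \<alpha> (gen_poly \<alpha>) G" and w: "power_series_coeffs G w"
  shows "summable (\<lambda>l. w l * u (t - real l * \<tau>))"
    and "diff_op w \<alpha> \<tau> u t = of_real (1 / (2 * pi)) *
      (LINT \<omega>|lborel. fourier u \<omega> * (exp (- \<i> * of_real (\<omega> * t)) *
         (of_real (\<tau> powr (- \<alpha>)) * gen_fun \<alpha> (exp (\<i> * of_real (\<omega> * \<tau>))))))"
proof -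
  note [measurable] = fourier_measurable_frac_class[OF u]
  have sw: "summable (\<lambda>l. norm (w l))" by (rule generating_coeffs(1)[OF \<alpha> branch w])
  let ?f = "\<lambda>l \<omega>. fourier u \<omega> * (exp (- \<i> * of_real (\<omega> * t)) * (w l * exp (\<i> * of_real (\<omega> * \<tau>)) ^ l))"
  have nf: "norm (?f l \<omega>) = norm (w l) * norm (fourier u \<omega>)" for l \<omega>
    by (simp add: norm_mult norm_power)
  have int: "integrable lborel (?f l)" for l
  proof (rule Bochner_Integration.integrable_bound)
    show "integrable lborel (\<lambda>\<omega>. norm (w l) * norm (fourier u \<omega>))"
      by (intro integrable_mult_right integrable_norm frac_class_inversion(1)[OF u \<alpha>(1)])
  qed (measurable, simp only: nf, simp)
  have "(\<lambda>l. integral\<^sup>L lborel (?f l)) sums (LINT \<omega>|lborel. (\<Sum>l. ?f l \<omega>))"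
  proof (rule sums_integral[OF int])
    show "AE \<omega> in lborel. summable (\<lambda>l. norm (?f l \<omega>))"
      unfolding nf by (intro AE_I2 summable_mult2 sw)
    show "summable (\<lambda>l. LINT \<omega>|lborel. norm (?f l \<omega>))"
      unfolding nf integral_mult_right_zero by (intro summable_mult2 sw)
  qed
  moreover have "(\<Sum>l. ?f l \<omega>) = fourier u \<omega> * (exp (- \<i> * of_real (\<omega> * t)) * gen_fun \<alpha> (exp (\<i> * of_real (\<omega> * \<tau>))))" for \<omega>
  proof -
    have "(\<lambda>l. w l * exp (\<i> * of_real (\<omega> * \<tau>)) ^ l) sums gen_fun \<alpha> (exp (\<i> * of_real (\<omega> * \<tau>)))"
      by (rule generating_coeffs(2)[OF \<alpha> branch w]) simp
    from sums_unique[OF sums_mult[OF sums_mult[OF this]]] show ?thesis by simp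
  qed
  moreover have "w l * u (t - real l * \<tau>) = of_real (1 / (2 * pi)) * integral\<^sup>L lborel (?f l)" for l
  proof -
    have "?f l \<omega> = w l * (exp (- \<i> * of_real (\<omega> * (t - real l * \<tau>))) * fourier u \<omega>)" for \<omega>
      by (simp add: algebra_simps flip: exp_of_nat_mult exp_add)
    then have "integral\<^sup>L lborel (?f l) = w l * (LINT \<omega>|lborel. exp (- \<i> * of_real (\<omega> * (t - real l * \<tau>))) * fourier u \<omega>)"
      by (simp only: integral_mult_right_zero)
    then show ?thesis
      by (subst frac_class_inversion(2)[OF u \<alpha>(1)]) (simp only: mult_ac)
  qed
  ultimately have sums: "(\<lambda>l. w l * u (t - real l * \<tau>)) sums (of_real (1 / (2 * pi)) *
      (LINT \<omega>|lborel. fourier u \<omega> * (exp (- \<i> * of_real (\<omega> * t)) * gen_fun \<alpha> (exp (\<i> * of_real (\<omega> * \<tau>))))))"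
    by (simp only: sums_mult)
  then show "summable (\<lambda>l. w l * u (t - real l * \<tau>))" by (rule sums_summable)
  have "diff_op w \<alpha> \<tau> u t = of_real (1 / (2 * pi)) * (of_real (\<tau> powr (- \<alpha>)) *
      (LINT \<omega>|lborel. fourier u \<omega> * (exp (- \<i> * of_real (\<omega> * t)) * gen_fun \<alpha> (exp (\<i> * of_real (\<omega> * \<tau>))))))"
    unfolding diff_op_def sums_unique[OF sums, symmetric] by (simp only: mult_ac)
  then show "diff_op w \<alpha> \<tau> u t = of_real (1 / (2 * pi)) *
      (LINT \<omega>|lborel. fourier u \<omega> * (exp (- \<i> * of_real (\<omega> * t)) *
         (of_real (\<tau> powr (- \<alpha>)) * gen_fun \<alpha> (exp (\<i> * of_real (\<omega> * \<tau>))))))"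
    unfolding integral_mult_right_zero[symmetric] by (simp only: mult_ac)
qed

section \<open>The error of the difference operator\<close>

lemma gen_fun_continuous_on_cball:
  assumes "0 < \<alpha>"
  shows "continuous_on (cball 0 1) (gen_fun \<alpha>)"
  unfolding gen_fun_def using assms Re_one_minus_nonneg Re_second_factor[OF assms]
  by (intro continuous_intros) (force simp: dist_norm)+

text \<open>The constant is uniform in \<open>t\<close> because the phase
  \<open>e^(-i\<omega>t)\<close> has modulus 1, and it serves all \<open>\<tau> > 0\<close> because
  the symbol estimate holds for all real \<open>x\<close>.\<close>

proposition diff_op_error:
  fixes u :: "real \<Rightarrow> complex"
  assumes \<alpha>: "0 < \<alpha>" "\<alpha> < 1" and u: "u \<in> frac_class 2 \<alpha>"
    and branch: "positive_power_branch \<alpha> (gen_poly \<alpha>) G" and w: "power_series_coeffs G w"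
  obtains K where "\<And>t \<tau>. \<tau> > 0 \<Longrightarrow> norm (RL_deriv \<alpha> u (t + \<tau> / 2) - diff_op w \<alpha> \<tau> u t) \<le> K * \<tau>\<^sup>2"
proof -
  note [measurable] = fourier_measurable_frac_class[OF u]
  obtain C where C: "C \<ge> 0" "\<And>x. norm ((- \<i> * of_real x) powr of_real \<alpha> * exp (- \<i> * of_real x / 2)
           - gen_fun \<alpha> (exp (\<i> * of_real x))) \<le> C * \<bar>x\<bar> powr (2 + \<alpha>)"
    using symbol_estimate[OF \<alpha>(1)] by blast
  define I where "I = (LINT \<omega>|lborel. \<bar>\<omega>\<bar> powr (2 + \<alpha>) * norm (fourier u \<omega>))"
  have intI: "integrable lborel (\<lambda>\<omega>. \<bar>\<omega>\<bar> powr (2 + \<alpha>) * norm (fourier u \<omega>))"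
    using \<alpha> by (intro integrable_powr_fourier[OF u]) auto
  show ?thesis
  proof (rule that[of "1 / (2 * pi) * (C * I)"])
    fix t \<tau> :: real assume \<tau>: "\<tau> > 0"
    let ?z = "\<lambda>\<omega>. exp (\<i> * of_real (\<omega> * \<tau>))"
    let ?a = "\<lambda>\<omega>. fourier u \<omega> * (exp (- \<i> * of_real (\<omega> * (t + \<tau> / 2))) * (- \<i> * of_real \<omega>) powr of_real \<alpha>)"
    let ?b = "\<lambda>\<omega>. fourier u \<omega> * (exp (- \<i> * of_real (\<omega> * t)) * (of_real (\<tau> powr (- \<alpha>)) * gen_fun \<alpha> (?z \<omega>)))"
    have [measurable]: "(\<lambda>\<omega>. gen_fun \<alpha> (?z \<omega>)) \<in> borel_measurable borel"
      by (intro borel_measurable_continuous_onI continuous_on_compose2[OF gen_fun_continuous_on_cball[OF \<alpha>(1)]] continuous_intros)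
         auto
    have a: "integrable lborel ?a"
    proof (rule Bochner_Integration.integrable_bound)
      show "integrable lborel (\<lambda>\<omega>. \<bar>\<omega>\<bar> powr \<alpha> * norm (fourier u \<omega>))"
        using \<alpha> by (intro integrable_powr_fourier[OF u]) auto
    qed (measurable, simp add: norm_mult norm_powr_real_powr')
    have b: "integrable lborel ?b"
    proof (rule Bochner_Integration.integrable_bound)
      let ?M = "\<tau> powr (- \<alpha>) * (2 powr \<alpha> * (gen_A \<alpha> + gen_B \<alpha>) powr \<alpha>)"
      show "integrable lborel (\<lambda>\<omega>. norm (fourier u \<omega>) * ?M)"
        by (intro integrable_mult_left integrable_norm frac_class_inversion(1)[OF u \<alpha>(1)])
      show "AE \<omega> in lborel. norm (?b \<omega>) \<le> norm (norm (fourier u \<omega>) * ?M)"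
        using norm_gen_fun_le[OF \<alpha>(1), of "?z _"]
        by (intro AE_I2) (auto simp: norm_mult abs_mult intro!: mult_left_mono)
    qed measurable
    have ab: "norm (?a \<omega> - ?b \<omega>) \<le> C * \<tau>\<^sup>2 * (\<bar>\<omega>\<bar> powr (2 + \<alpha>) * norm (fourier u \<omega>))" for \<omega>
    proof -
      let ?x = "\<omega> * \<tau>"
      \<comment> \<open>Homogeneity of the principal power under the positive factor
        \<open>\<tau>\<close> brings both symbols to the variable \<open>x\<close>; evaluation at
        \<open>t + \<tau> / 2\<close> contributes \<open>e^(-ix/2)\<close>.\<close>
      have "(- \<i> * of_real ?x) powr of_real \<alpha> = of_real (\<tau> powr \<alpha>) * (- \<i> * of_real \<omega>) powr of_real \<alpha>"
        using \<tau> powr_times_real_left[of "of_real \<tau>" "- \<i> * of_real \<omega>" "of_real \<alpha>"]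
        by (simp add: powr_of_real mult_ac)
      then have p: "(- \<i> * of_real \<omega>) powr of_real \<alpha> = of_real (\<tau> powr (- \<alpha>)) * (- \<i> * of_real ?x) powr of_real \<alpha>"
        using \<tau> by (simp add: powr_minus)
      have e: "exp (- \<i> * of_real (\<omega> * (t + \<tau> / 2))) = exp (- \<i> * of_real (\<omega> * t)) * exp (- \<i> * of_real ?x / 2)"
        by (simp add: algebra_simps flip: exp_add)
      have "?a \<omega> - ?b \<omega> = fourier u \<omega> * (exp (- \<i> * of_real (\<omega> * t)) * (of_real (\<tau> powr (- \<alpha>)) *
          ((- \<i> * of_real ?x) powr of_real \<alpha> * exp (- \<i> * of_real ?x / 2) - gen_fun \<alpha> (?z \<omega>))))"
        unfolding p e by (simp only: right_diff_distrib mult_ac)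
      then have "norm (?a \<omega> - ?b \<omega>) = norm (fourier u \<omega>) * (\<tau> powr (- \<alpha>) *
          norm ((- \<i> * of_real ?x) powr of_real \<alpha> * exp (- \<i> * of_real ?x / 2) - gen_fun \<alpha> (?z \<omega>)))"
        by (simp only: norm_mult) simp
      also have "\<dots> \<le> norm (fourier u \<omega>) * (\<tau> powr (- \<alpha>) * (C * \<bar>?x\<bar> powr (2 + \<alpha>)))"
        by (intro mult_left_mono C) auto
      also have "\<bar>?x\<bar> powr (2 + \<alpha>) = \<bar>\<omega>\<bar> powr (2 + \<alpha>) * (\<tau>\<^sup>2 * \<tau> powr \<alpha>)"
        using \<tau> by (simp add: abs_mult powr_mult powr_add[of \<tau>] powr_numeral)
      also have "norm (fourier u \<omega>) * (\<tau> powr (- \<alpha>) * (C * (\<bar>\<omega>\<bar> powr (2 + \<alpha>) * (\<tau>\<^sup>2 * \<tau> powr \<alpha>))))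
          = C * \<tau>\<^sup>2 * (\<bar>\<omega>\<bar> powr (2 + \<alpha>) * norm (fourier u \<omega>)) * (\<tau> powr (- \<alpha>) * \<tau> powr \<alpha>)"
        by (simp only: mult_ac)
      also have "\<tau> powr (- \<alpha>) * \<tau> powr \<alpha> = 1" using \<tau> by (simp flip: powr_add)
      finally show ?thesis by simp
    qed
    have "RL_deriv \<alpha> u (t + \<tau> / 2) - diff_op w \<alpha> \<tau> u t = of_real (1 / (2 * pi)) * (LINT \<omega>|lborel. ?a \<omega> - ?b \<omega>)"
      unfolding RL_deriv_fourier[OF \<alpha> u] diff_op_fourier(2)[OF \<alpha> u branch w]
        Bochner_Integration.integral_diff[OF a b] by (simp only: right_diff_distrib)
    then have "norm (RL_deriv \<alpha> u (t + \<tau> / 2) - diff_op w \<alpha> \<tau> u t) = 1 / (2 * pi) * norm (LINT \<omega>|lborel. ?a \<omega> - ?b \<omega>)"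
      by (simp only: norm_mult norm_of_real) simp
    also have "\<dots> \<le> 1 / (2 * pi) * (LINT \<omega>|lborel. C * \<tau>\<^sup>2 * (\<bar>\<omega>\<bar> powr (2 + \<alpha>) * norm (fourier u \<omega>)))"
    proof (rule mult_left_mono)
      show "norm (LINT \<omega>|lborel. ?a \<omega> - ?b \<omega>)
          \<le> (LINT \<omega>|lborel. C * \<tau>\<^sup>2 * (\<bar>\<omega>\<bar> powr (2 + \<alpha>) * norm (fourier u \<omega>)))"
        by (rule Bochner_Integration.integral_norm_bound_integral[OF Bochner_Integration.integrable_diff[OF a b]
              integrable_mult_right[OF intI] ab])
    qed simp
    also have "\<dots> = 1 / (2 * pi) * (C * I) * \<tau>\<^sup>2"
      by (simp add: I_def)
    finally show "norm (RL_deriv \<alpha> u (t + \<tau> / 2) - diff_op w \<alpha> \<tau> u t) \<le> 1 / (2 * pi) * (C * I) * \<tau>\<^sup>2" .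
  qed
qed

text \<open>The first two conjuncts certify that the derivative and the series exist:
  \<open>RL_deriv\<close> and \<open>suminf\<close> are total, so the estimate alone would not
  exclude default values.\<close>

theorem theorem2p1:
  fixes \<alpha> :: real and u :: "real \<Rightarrow> complex"
    and G :: "complex \<Rightarrow> complex" and w :: "nat \<Rightarrow> complex"
  assumes "0 < \<alpha>" and "\<alpha> < 1"
    and "u \<in> frac_class 2 \<alpha>"
    and "positive_power_branch \<alpha> (gen_poly \<alpha>) G"
    and "power_series_coeffs G w"
  shows "(\<forall>t. has_RL_deriv_at \<alpha> u t) \<and>
    (\<forall>\<tau>>0. \<forall>t. summable (\<lambda>l. w l * u (t - real l * \<tau>))) \<and>
    (\<forall>t. (\<lambda>\<tau>. RL_deriv \<alpha> u (t + \<tau> / 2) - diff_op w \<alpha> \<tau> u t)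
            \<in> O[at_right 0](\<lambda>\<tau>. of_real (\<tau>\<^sup>2)))"
proof (intro conjI allI impI)
  show "has_RL_deriv_at \<alpha> u t" for t
    by (rule has_RL_deriv_at_frac_class[OF assms(1-3)])
  show "summable (\<lambda>l. w l * u (t - real l * \<tau>))" for t \<tau>
    by (rule diff_op_fourier(1)[OF assms])
  obtain K where K: "\<And>t \<tau>. \<tau> > 0 \<Longrightarrow> norm (RL_deriv \<alpha> u (t + \<tau> / 2) - diff_op w \<alpha> \<tau> u t) \<le> K * \<tau>\<^sup>2"
    using diff_op_error[OF assms] by blast
  show "(\<lambda>\<tau>. RL_deriv \<alpha> u (t + \<tau> / 2) - diff_op w \<alpha> \<tau> u t) \<in> O[at_right 0](\<lambda>\<tau>. of_real (\<tau>\<^sup>2))" for t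
    by (rule bigoI[where c = K], rule eventually_mono[OF eventually_at_right_less[of 0]])
       (use K in \<open>simp add: norm_power\<close>)
qed

end
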